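(* Let $p \geqslant 3$ and $n \geqslant 0$ be integers, and let $P$ be an $(n+3)$-gon. There is a bijection between the set of $p$-angulations of $P$ and the set of frieze patterns of type $\Lambda_p$ and width $n$.
   Context: A frieze pattern of width $n$ consists of $n+4$ infinite horizontal rows of non-negative real numbers, numbered $0$ through $n+3$ from below, with an offset between even and odd rows (so entries of consecutive rows interlace). Rows $0$ and $n+3$ consist of zeroes, rows $1$ and $n+2$ consist of ones, rows $2$ through $n+1$ consist of positive real numbers, and every "diamond" of four entries, with $b$ on top, $a$ on the left, $d$ on the right and $c$ at the bottom, satisfies $ad-bc=1$. Row $2$ is the quiddity row; it determines the whole frieze pattern. Set $\lambda_p = 2\cos(\pi/p)$. A frieze pattern is of type $\Lambda_p$ if every entry of its quiddity row is an integral multiple of $\lambda_p$. A polygon is a finite set of at least three vertices with a cyclic ordering; a diagonal is a pair of non-adjacent vertices, and two diagonals $\{\alpha,\beta\},\{\gamma,\delta\}$ cross if the four vertices are distinct and appear in the cyclic order as $\alpha,\gamma,\beta,\delta$ or $\alpha,\delta,\beta,\gamma$. A polygon dissection is a set of pairwise non-crossing diagonals; it splits the polygon into subpolygons, and it is a $p$-angulation if every subpolygon is a $p$-gon. *)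

theory Defs
  imports Complex_Main
begin

text \<open>
  A cyclic ordering of \<open>V\<close> is a ternary relation: \<open>cyc a b c\<close> means that \<open>a, b, c\<close> are distinct and
  are met in this order when running around \<open>V\<close> in the positive direction.  Distinctness follows
  from the first two axioms.  Nothing is assumed about \<open>cyc\<close> outside \<open>V\<close>, and a cyclic ordering
  of \<open>V\<close> is also one of each subset of \<open>V\<close>.
\<close>

definition cyclic_ordering_on :: "'a set \<Rightarrow> ('a \<Rightarrow> 'a \<Rightarrow> 'a \<Rightarrow> bool) \<Rightarrow> bool" where
  "cyclic_ordering_on V cyc \<longleftrightarrow>
     (\<forall>a\<in>V. \<forall>b\<in>V. \<forall>c\<in>V. cyc a b c \<longrightarrow> cyc b c a) \<and>
     (\<forall>a\<in>V. \<forall>b\<in>V. \<forall>c\<in>V. cyc a b c \<longrightarrow> \<not> cyc c b a) \<and>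
     (\<forall>a\<in>V. \<forall>b\<in>V. \<forall>c\<in>V. \<forall>d\<in>V. cyc a b c \<longrightarrow> cyc a c d \<longrightarrow> cyc a b d) \<and>
     (\<forall>a\<in>V. \<forall>b\<in>V. \<forall>c\<in>V. a \<noteq> b \<longrightarrow> b \<noteq> c \<longrightarrow> a \<noteq> c \<longrightarrow> cyc a b c \<or> cyc c b a)"

definition polygon :: "'a set \<Rightarrow> ('a \<Rightarrow> 'a \<Rightarrow> 'a \<Rightarrow> bool) \<Rightarrow> bool" where
  "polygon V cyc \<longleftrightarrow> finite V \<and> 3 \<le> card V \<and> cyclic_ordering_on V cyc"

definition next_vertex :: "'a set \<Rightarrow> ('a \<Rightarrow> 'a \<Rightarrow> 'a \<Rightarrow> bool) \<Rightarrow> 'a \<Rightarrow> 'a \<Rightarrow> bool" where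
  "next_vertex V cyc x y \<longleftrightarrow> x \<in> V \<and> y \<in> V \<and> x \<noteq> y \<and> (\<forall>z\<in>V. \<not> cyc x z y)"

definition adjacent :: "'a set \<Rightarrow> ('a \<Rightarrow> 'a \<Rightarrow> 'a \<Rightarrow> bool) \<Rightarrow> 'a \<Rightarrow> 'a \<Rightarrow> bool" where
  "adjacent V cyc x y \<longleftrightarrow> next_vertex V cyc x y \<or> next_vertex V cyc y x"

definition polygon_edges :: "'a set \<Rightarrow> ('a \<Rightarrow> 'a \<Rightarrow> 'a \<Rightarrow> bool) \<Rightarrow> 'a set set" where
  "polygon_edges V cyc = {{x, y} | x y. adjacent V cyc x y}"

definition diagonals :: "'a set \<Rightarrow> ('a \<Rightarrow> 'a \<Rightarrow> 'a \<Rightarrow> bool) \<Rightarrow> 'a set set" where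
  "diagonals V cyc = {{x, y} | x y. x \<in> V \<and> y \<in> V \<and> x \<noteq> y \<and> \<not> adjacent V cyc x y}"

definition in_cyclic_order :: "('a \<Rightarrow> 'a \<Rightarrow> 'a \<Rightarrow> bool) \<Rightarrow> 'a \<Rightarrow> 'a \<Rightarrow> 'a \<Rightarrow> 'a \<Rightarrow> bool" where
  "in_cyclic_order cyc a b c d \<longleftrightarrow> cyc a b c \<and> cyc a c d"

definition crossing :: "('a \<Rightarrow> 'a \<Rightarrow> 'a \<Rightarrow> bool) \<Rightarrow> 'a set \<Rightarrow> 'a set \<Rightarrow> bool" where
  "crossing cyc d e \<longleftrightarrow>
     (\<exists>\<alpha> \<beta> \<gamma> \<delta>. d = {\<alpha>, \<beta>} \<and> e = {\<gamma>, \<delta>} \<and> distinct [\<alpha>, \<beta>, \<gamma>, \<delta>] \<and>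
        (in_cyclic_order cyc \<alpha> \<gamma> \<beta> \<delta> \<or> in_cyclic_order cyc \<alpha> \<delta> \<beta> \<gamma>))"

definition polygon_dissection ::
  "'a set \<Rightarrow> ('a \<Rightarrow> 'a \<Rightarrow> 'a \<Rightarrow> bool) \<Rightarrow> 'a set set \<Rightarrow> bool" where
  "polygon_dissection V cyc D \<longleftrightarrow>
     D \<subseteq> diagonals V cyc \<and> (\<forall>d\<in>D. \<forall>e\<in>D. \<not> crossing cyc d e)"

text \<open>
  A subpolygon is given by its vertex set \<open>S\<close>, with the cyclic ordering inherited from \<open>V\<close>: it is
  bounded by edges of the polygon and diagonals of the dissection, and no diagonal of the
  dissection runs through its interior.
\<close>

definition subpolygons ::
  "'a set \<Rightarrow> ('a \<Rightarrow> 'a \<Rightarrow> 'a \<Rightarrow> bool) \<Rightarrow> 'a set set \<Rightarrow> 'a set set" where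
  "subpolygons V cyc D =
     {S. S \<subseteq> V \<and> polygon S cyc \<and> polygon_edges S cyc \<subseteq> polygon_edges V cyc \<union> D \<and>
         diagonals S cyc \<inter> D = {}}"

definition p_angulation ::
  "nat \<Rightarrow> 'a set \<Rightarrow> ('a \<Rightarrow> 'a \<Rightarrow> 'a \<Rightarrow> bool) \<Rightarrow> 'a set set \<Rightarrow> bool" where
  "p_angulation p V cyc D \<longleftrightarrow>
     polygon_dissection V cyc D \<and> (\<forall>S\<in>subpolygons V cyc D. card S = p)"

text \<open>
  \<open>F r k\<close> is the \<open>k\<close>-th entry of row \<open>r\<close>, drawn at horizontal position \<open>2 * k + r\<close>.  Hence the
  diamond with bottom entry \<open>F r (k + 1)\<close> has left entry \<open>F (r + 1) k\<close>, right entry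
  \<open>F (r + 1) (k + 1)\<close> and top entry \<open>F (r + 2) k\<close>.  The last condition only fixes the values at
  the non-existing rows, so that each frieze pattern is represented by exactly one function.
\<close>

definition frieze_pattern :: "nat \<Rightarrow> (nat \<Rightarrow> int \<Rightarrow> real) \<Rightarrow> bool" where
  "frieze_pattern n F \<longleftrightarrow>
     (\<forall>k. F 0 k = 0) \<and> (\<forall>k. F (n + 3) k = 0) \<and>
     (\<forall>k. F 1 k = 1) \<and> (\<forall>k. F (n + 2) k = 1) \<and>
     (\<forall>r\<in>{2..n + 1}. \<forall>k. F r k > 0) \<and>
     (\<forall>r\<le>n + 1. \<forall>k. F (r + 1) k * F (r + 1) (k + 1) - F (r + 2) k * F r (k + 1) = 1) \<and>
     (\<forall>r>n + 3. \<forall>k. F r k = 0)"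

definition frieze_lambda :: "nat \<Rightarrow> real" where
  "frieze_lambda p = 2 * cos (pi / real p)"

definition quiddity_row :: "(nat \<Rightarrow> int \<Rightarrow> real) \<Rightarrow> int \<Rightarrow> real" where
  "quiddity_row F = F 2"

definition of_type_Lambda :: "nat \<Rightarrow> (nat \<Rightarrow> int \<Rightarrow> real) \<Rightarrow> bool" where
  "of_type_Lambda p F \<longleftrightarrow> (\<forall>k. \<exists>m::int. quiddity_row F k = of_int m * frieze_lambda p)"

end

theory Submission
  imports Defs
begin

text \<open>
  A frieze pattern of width \<open>n\<close> is the same as a sequence of \<open>n + 3\<close> plane vectors, up to
  \<open>SL\<^sub>2\<close>, whose wedge products are positive in increasing order and \<open>1\<close> along the edges of the
  polygon; the wedge products are the entries of the frieze, and they satisfy the Ptolemy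
  (Pluecker) relation.  The bijection sends a frieze pattern to the set of diagonals with entry \<open>1\<close>.

  If \<open>{a, b}\<close> is a diagonal with entry \<open>1\<close>, the Ptolemy relation glues realizations of the two
  sides of \<open>{a, b}\<close> to one of the whole polygon, the quiddities at \<open>a\<close> and \<open>b\<close> being added, and
  every entry across \<open>{a, b}\<close> is at least \<open>2\<close> as soon as all others are at least \<open>1\<close>.
  The regular \<open>p\<close>-gon has the entries \<open>sin (k \<pi> / p) / sin (\<pi> / p)\<close> and quiddity \<open>\<lambda>\<close>.
  Hence a \<open>p\<close>-angulation is realized by gluing regular \<open>p\<close>-gons, and its quiddity at a vertex is
  \<open>\<lambda>\<close> times the number of \<open>p\<close>-gons at that vertex; since the quiddity row determines the frieze,
  so does the \<open>p\<close>-angulation.  Conversely, in a frieze pattern of type \<open>\<Lambda>\<^sub>p\<close> a growth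
  estimate produces \<open>p - 2\<close> consecutive quiddities equal to \<open>\<lambda>\<close>.  They span a regular \<open>p\<close>-gon,
  and cutting it off leaves a smaller frieze pattern of type \<open>\<Lambda>\<^sub>p\<close>.
\<close>

section \<open>Dissections of polygons with vertices in the natural numbers\<close>

text \<open>Running upwards through the naturals and jumping from the largest element back to the
  smallest. Every polygon is carried into this model at the end, so that statements about the cyclic
  order become inequalities.\<close>

definition nat_cyc :: "nat \<Rightarrow> nat \<Rightarrow> nat \<Rightarrow> bool" where
  "nat_cyc a b c \<longleftrightarrow> a < b \<and> b < c \<or> b < c \<and> c < a \<or> c < a \<and> a < b"

lemma nat_cyc_less:
  assumes "x < y"
  shows "nat_cyc x z y \<longleftrightarrow> x < z \<and> z < y" and "nat_cyc y z x \<longleftrightarrow> z < x \<or> y < z"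
    and "nat_cyc x y z \<longleftrightarrow> z < x \<or> y < z" and "nat_cyc y x z \<longleftrightarrow> x < z \<and> z < y"
  unfolding nat_cyc_def using assms by linarith+

lemma cyclic_ordering_on_nat_cyc: "cyclic_ordering_on V nat_cyc"
  unfolding cyclic_ordering_on_def
proof (intro conjI ballI impI)
  fix a b c d :: nat
  show "nat_cyc a b c \<Longrightarrow> nat_cyc b c a" "nat_cyc a b c \<Longrightarrow> \<not> nat_cyc c b a"
    "nat_cyc a b c \<Longrightarrow> nat_cyc a c d \<Longrightarrow> nat_cyc a b d"
    "a \<noteq> b \<Longrightarrow> b \<noteq> c \<Longrightarrow> a \<noteq> c \<Longrightarrow> nat_cyc a b c \<or> nat_cyc c b a"
    unfolding nat_cyc_def by linarith+
qed

lemma polygon_nat_cyc: "polygon V nat_cyc \<longleftrightarrow> finite V \<and> 3 \<le> card V"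
  unfolding polygon_def using cyclic_ordering_on_nat_cyc by simp

text \<open>Normal form of a diagonal: both open arcs between its ends contain a vertex, and
  \<open>x < y\<close> leaves one representative for each unordered pair.\<close>

definition sep_pair :: "nat set \<Rightarrow> nat \<Rightarrow> nat \<Rightarrow> bool" where
  "sep_pair V x y \<longleftrightarrow> x \<in> V \<and> y \<in> V \<and> x < y \<and>
     (\<exists>z\<in>V. x < z \<and> z < y) \<and> (\<exists>z\<in>V. z < x \<or> y < z)"

lemma adjacent_nat_cyc:
  assumes "x < y"
  shows "adjacent V nat_cyc x y \<longleftrightarrow> x \<in> V \<and> y \<in> V \<and> \<not> sep_pair V x y"
    and "adjacent V nat_cyc y x \<longleftrightarrow> x \<in> V \<and> y \<in> V \<and> \<not> sep_pair V x y"
proof -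
  have "next_vertex V nat_cyc x y \<longleftrightarrow> x \<in> V \<and> y \<in> V \<and> (\<forall>z\<in>V. \<not> (x < z \<and> z < y))"
    using assms nat_cyc_less[OF assms] unfolding next_vertex_def by auto
  moreover have "next_vertex V nat_cyc y x \<longleftrightarrow> x \<in> V \<and> y \<in> V \<and> (\<forall>z\<in>V. \<not> (z < x \<or> y < z))"
    using assms nat_cyc_less[OF assms] unfolding next_vertex_def by auto
  ultimately show "adjacent V nat_cyc x y \<longleftrightarrow> x \<in> V \<and> y \<in> V \<and> \<not> sep_pair V x y"
    and "adjacent V nat_cyc y x \<longleftrightarrow> x \<in> V \<and> y \<in> V \<and> \<not> sep_pair V x y"
    using assms unfolding adjacent_def sep_pair_def by blast+
qed

lemma diagonals_nat_cyc: "diagonals V nat_cyc = {{x, y} | x y. sep_pair V x y}"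
proof (intro equalityI subsetI)
  fix d assume "d \<in> diagonals V nat_cyc"
  then obtain x y where d: "d = {x, y}" "x \<in> V" "y \<in> V" "x \<noteq> y" "\<not> adjacent V nat_cyc x y"
    unfolding diagonals_def by auto
  then consider "x < y" | "y < x" by linarith
  then show "d \<in> {{x, y} | x y. sep_pair V x y}"
    using d adjacent_nat_cyc[of x y V] adjacent_nat_cyc[of y x V] by cases (auto simp: doubleton_eq_iff)
next
  fix d assume "d \<in> {{x, y} | x y. sep_pair V x y}"
  then obtain x y where d: "d = {x, y}" "sep_pair V x y" by auto
  then have "\<not> adjacent V nat_cyc x y" "x \<in> V" "y \<in> V" "x \<noteq> y"
    using adjacent_nat_cyc[of x y V] by (auto simp: sep_pair_def)
  then show "d \<in> diagonals V nat_cyc"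
    using d unfolding diagonals_def by blast
qed

lemma pair_in_diagonals:
  assumes "x < y"
  shows "{x, y} \<in> diagonals V nat_cyc \<longleftrightarrow> sep_pair V x y"
  using assms unfolding diagonals_nat_cyc by (auto simp: doubleton_eq_iff sep_pair_def)

lemma polygon_edges_nat_cyc:
  "polygon_edges V nat_cyc = {{x, y} | x y. x \<in> V \<and> y \<in> V \<and> x < y \<and> \<not> sep_pair V x y}"
proof (intro equalityI subsetI)
  fix d assume "d \<in> polygon_edges V nat_cyc"
  then obtain x y where d: "d = {x, y}" "adjacent V nat_cyc x y"
    unfolding polygon_edges_def by auto
  then have "x \<noteq> y" unfolding adjacent_def next_vertex_def by auto
  then consider "x < y" | "y < x" by linarith
  then show "d \<in> {{x, y} | x y. x \<in> V \<and> y \<in> V \<and> x < y \<and> \<not> sep_pair V x y}"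
    using d adjacent_nat_cyc[of x y V] adjacent_nat_cyc[of y x V] by cases (auto simp: doubleton_eq_iff)
next
  fix d assume "d \<in> {{x, y} | x y. x \<in> V \<and> y \<in> V \<and> x < y \<and> \<not> sep_pair V x y}"
  then show "d \<in> polygon_edges V nat_cyc"
    using adjacent_nat_cyc(1) unfolding polygon_edges_def by blast
qed

lemma pair_in_polygon_edges:
  assumes "x < y"
  shows "{x, y} \<in> polygon_edges V nat_cyc \<longleftrightarrow> x \<in> V \<and> y \<in> V \<and> \<not> sep_pair V x y"
  using assms unfolding polygon_edges_nat_cyc by (auto simp: doubleton_eq_iff)

lemma crossing_nat_cyc:
  assumes "x < y" "z < w"
  shows "crossing nat_cyc {x, y} {z, w} \<longleftrightarrow> x < z \<and> z < y \<and> y < w \<or> z < x \<and> x < w \<and> w < y"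
proof
  assume "crossing nat_cyc {x, y} {z, w}"
  then obtain \<alpha> \<beta> \<gamma> \<delta> where *: "{x, y} = {\<alpha>, \<beta>}" "{z, w} = {\<gamma>, \<delta>}"
      "nat_cyc \<alpha> \<gamma> \<beta> \<and> nat_cyc \<alpha> \<beta> \<delta> \<or> nat_cyc \<alpha> \<delta> \<beta> \<and> nat_cyc \<alpha> \<beta> \<gamma>"
    unfolding crossing_def in_cyclic_order_def by metis
  have "\<alpha> = x \<and> \<beta> = y \<or> \<alpha> = y \<and> \<beta> = x" "\<gamma> = z \<and> \<delta> = w \<or> \<gamma> = w \<and> \<delta> = z"
    using *(1,2) by (auto simp: doubleton_eq_iff)
  then show "x < z \<and> z < y \<and> y < w \<or> z < x \<and> x < w \<and> w < y"
    using *(3) assms(2) nat_cyc_less[OF assms(1)] by (elim disjE conjE) simp_all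
next
  assume *: "x < z \<and> z < y \<and> y < w \<or> z < x \<and> x < w \<and> w < y"
  show "crossing nat_cyc {x, y} {z, w}"
    unfolding crossing_def
  proof (intro exI conjI)
    show "in_cyclic_order nat_cyc x z y w \<or> in_cyclic_order nat_cyc x w y z"
      using * unfolding in_cyclic_order_def nat_cyc_def by auto
  qed (use * in auto)
qed

lemma sep_pair_mono: "sep_pair S x y \<Longrightarrow> S \<subseteq> V \<Longrightarrow> sep_pair V x y"
  unfolding sep_pair_def by blast

lemma diagonals_mono: "S \<subseteq> V \<Longrightarrow> diagonals S nat_cyc \<subseteq> diagonals V nat_cyc"
  unfolding diagonals_nat_cyc using sep_pair_mono by blast

lemma polygon_edges_restrict:
  assumes "S \<subseteq> V" "d \<in> polygon_edges V nat_cyc" "d \<subseteq> S"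
  shows "d \<in> polygon_edges S nat_cyc"
  using assms sep_pair_mono[OF _ assms(1)] unfolding polygon_edges_nat_cyc by blast

lemma pair_edge_or_diagonal:
  assumes "d \<subseteq> S" "d \<in> diagonals V nat_cyc"
  shows "d \<in> polygon_edges S nat_cyc \<or> d \<in> diagonals S nat_cyc"
proof -
  obtain x y where "d = {x, y}" "x < y"
    using assms(2) unfolding diagonals_nat_cyc by (auto simp: sep_pair_def)
  then show ?thesis
    using assms(1) pair_in_polygon_edges[of x y S] pair_in_diagonals[of x y S] by auto
qed

lemma third_element:
  assumes "3 \<le> card S"
  shows "\<exists>z\<in>S. z \<noteq> x \<and> z \<noteq> y"
proof (rule ccontr)
  assume "\<not> ?thesis"
  then have "S \<subseteq> {x, y}" by blast
  then have "card S \<le> card {x, y}" by (intro card_mono) auto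
  also have "card {x, y} \<le> 2" by (simp add: card_insert_if)
  finally show False using assms by simp
qed

text \<open>A point off \<open>S\<close> falls into one gap of \<open>S\<close>: between two
  consecutive elements, or into the gap that wraps from the maximum to the minimum.\<close>

lemma polygon_edge_over:
  assumes "finite S" "2 \<le> card S" "w \<notin> S"
  obtains x y where "x \<in> S" "y \<in> S" "x < y" "\<not> sep_pair S x y"
    "(x < w \<and> w < y \<and> (\<forall>z\<in>S. z \<le> x \<or> y \<le> z)) \<or> ((w < x \<or> y < w) \<and> (\<forall>z\<in>S. x \<le> z \<and> z \<le> y))"
proof (cases "(\<exists>z\<in>S. z < w) \<and> (\<exists>z\<in>S. w < z)")
  case True
  define x where "x = Max {z\<in>S. z < w}"
  define y where "y = Min {z\<in>S. w < z}"
  have "x \<in> {z\<in>S. z < w}" unfolding x_def using True assms(1) by (intro Max_in) auto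
  moreover have "y \<in> {z\<in>S. w < z}" unfolding y_def using True assms(1) by (intro Min_in) auto
  moreover have "z \<le> x \<or> y \<le> z" if "z \<in> S" for z
  proof (cases "z < w")
    case True
    then have "z \<le> x" unfolding x_def using that assms(1) by (intro Max_ge) auto
    then show ?thesis ..
  next
    case False
    then have "w < z" using that assms(3) by (cases "z = w") auto
    then have "y \<le> z" unfolding y_def using that assms(1) by (intro Min_le) auto
    then show ?thesis ..
  qed
  ultimately show ?thesis
    by (intro that[of x y]) (auto simp: sep_pair_def not_less[symmetric])
next
  case False
  have ne: "S \<noteq> {}" using assms(2) by auto
  have x: "Min S \<in> S" and y: "Max S \<in> S" using assms(1) ne by auto
  have b: "Min S \<le> z \<and> z \<le> Max S" if "z \<in> S" for z using that assms(1) by auto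
  have "Min S \<noteq> Max S"
  proof
    assume "Min S = Max S"
    then have "S \<subseteq> {Min S}" using b by (metis le_antisym singletonI subsetI)
    then have "card S \<le> 1" using card_mono[of "{Min S}" S] by simp
    then show False using assms(2) by simp
  qed
  then have "Min S < Max S" using b[OF x] by simp
  moreover have "w < Min S \<or> Max S < w"
    using False x y assms(3) by (metis linorder_neqE_nat)
  moreover have "\<not> sep_pair S (Min S) (Max S)"
    using b unfolding sep_pair_def by (auto simp: not_less)
  ultimately show ?thesis using x y b by (intro that[of "Min S" "Max S"]) auto
qed

text \<open>A vertex outside \<open>S\<close> would lie behind an edge of \<open>S\<close> with a
  third vertex of \<open>S\<close> in front of it, so this edge would be a diagonal of
  \<open>V\<close>, which the empty dissection does not supply.\<close>

lemma subpolygons_empty: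
  assumes "finite V" "3 \<le> card V"
  shows "subpolygons V nat_cyc {} = {V}"
proof (intro equalityI subsetI)
  fix S assume S: "S \<in> subpolygons V nat_cyc {}"
  then have SV: "S \<subseteq> V" and S3: "finite S" "3 \<le> card S"
    and E: "polygon_edges S nat_cyc \<subseteq> polygon_edges V nat_cyc"
    by (auto simp: subpolygons_def polygon_nat_cyc)
  have "w \<in> S" if w: "w \<in> V" for w
  proof (rule ccontr)
    assume "w \<notin> S"
    then obtain x y where xy: "x \<in> S" "y \<in> S" "x < y" "\<not> sep_pair S x y"
      "(x < w \<and> w < y \<and> (\<forall>z\<in>S. z \<le> x \<or> y \<le> z)) \<or> ((w < x \<or> y < w) \<and> (\<forall>z\<in>S. x \<le> z \<and> z \<le> y))"
      using polygon_edge_over[of S w] S3 by auto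
    obtain z where z: "z \<in> S" "z \<noteq> x" "z \<noteq> y" using third_element[OF S3(2)] by blast
    have "x < w \<and> w < y \<and> (z < x \<or> y < z) \<or> (w < x \<or> y < w) \<and> x < z \<and> z < y"
      using xy(5) z by (metis le_neq_implies_less)
    then have "sep_pair V x y"
      using xy(1-3) z(1) w SV unfolding sep_pair_def by blast
    then show False
      using E xy pair_in_polygon_edges[of x y S] pair_in_polygon_edges[of x y V] by auto
  qed
  then show "S \<in> {V}" using SV by auto
qed (use assms in \<open>auto simp: subpolygons_def polygon_nat_cyc\<close>)

section \<open>Cutting a polygon along a diagonal\<close>

abbreviation inner :: "nat set \<Rightarrow> nat \<Rightarrow> nat \<Rightarrow> nat set" where
  "inner V a b \<equiv> V \<inter> {a..b}"

abbreviation outer :: "nat set \<Rightarrow> nat \<Rightarrow> nat \<Rightarrow> nat set" where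
  "outer V a b \<equiv> V - {a<..<b}"

text \<open>The arc between \<open>x\<close> and \<open>y\<close> survives entirely, and the other
  arc still contains \<open>a\<close> or \<open>b\<close> unless the chord is the cut
  itself.\<close>

lemma sep_pair_inner:
  assumes "a \<in> V" "b \<in> V" "sep_pair V x y" "a \<le> x" "y \<le> b" "\<not> (x = a \<and> y = b)"
  shows "sep_pair (inner V a b) x y"
proof -
  have "\<exists>w\<in>inner V a b. w < x \<or> y < w"
  proof (cases "x = a")
    case True
    then show ?thesis using assms by (intro bexI[of _ b]) (auto simp: sep_pair_def)
  next
    case False
    then show ?thesis using assms by (intro bexI[of _ a]) (auto simp: sep_pair_def)
  qed
  then show ?thesis using assms unfolding sep_pair_def by auto
qed

lemma sep_pair_outer:
  assumes "a \<in> V" "b \<in> V" "a < b" "sep_pair V x y" "x \<in> outer V a b" "y \<in> outer V a b"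
    and "\<not> (x = a \<and> y = b)"
  shows "sep_pair (outer V a b) x y"
proof -
  obtain z w where zw: "z \<in> V" "x < z" "z < y" "w \<in> V" "w < x \<or> y < w" "x < y"
    using assms(4) unfolding sep_pair_def by blast
  have ab: "a \<in> outer V a b" "b \<in> outer V a b" using assms by auto
  consider "y \<le> a" | "b \<le> x" | "x \<le> a" "b \<le> y" using assms by fastforce
  then show ?thesis
  proof cases
    case 1
    then have "z \<in> outer V a b" "y < b" using zw assms(3) by auto
    then show ?thesis using ab zw assms(5,6) unfolding sep_pair_def by blast
  next
    case 2
    then have "z \<in> outer V a b" "a < x" using zw assms(3) by auto
    then show ?thesis using ab zw assms(5,6) unfolding sep_pair_def by blast
  next
    case 3
    \<comment> \<open>The vertices found between \<open>x\<close> and \<open>y\<close> may have been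
      removed; \<open>a\<close> or \<open>b\<close> takes their place.\<close>
    then have "w \<in> outer V a b" using zw by auto
    moreover have "x < a \<and> a < y \<or> x < b \<and> b < y" using 3 assms(3,7) by auto
    ultimately show ?thesis using ab zw assms(5,6) unfolding sep_pair_def by blast
  qed
qed

lemma polygon_edges_inner:
  assumes "a \<in> V" "b \<in> V"
  shows "polygon_edges (inner V a b) nat_cyc \<subseteq> insert {a, b} (polygon_edges V nat_cyc)"
proof
  fix d assume "d \<in> polygon_edges (inner V a b) nat_cyc"
  then obtain x y where d: "d = {x, y}" "x \<in> inner V a b" "y \<in> inner V a b" "x < y"
     "\<not> sep_pair (inner V a b) x y"
    unfolding polygon_edges_nat_cyc by auto
  then have "x = a \<and> y = b \<or> \<not> sep_pair V x y"
    using sep_pair_inner[OF assms, of x y] by auto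
  then show "d \<in> insert {a, b} (polygon_edges V nat_cyc)"
    using d pair_in_polygon_edges[of x y V] by auto
qed

lemma polygon_edges_outer:
  assumes "a \<in> V" "b \<in> V" "a < b"
  shows "polygon_edges (outer V a b) nat_cyc \<subseteq> insert {a, b} (polygon_edges V nat_cyc)"
proof
  fix d assume "d \<in> polygon_edges (outer V a b) nat_cyc"
  then obtain x y where d: "d = {x, y}" "x \<in> outer V a b" "y \<in> outer V a b" "x < y"
     "\<not> sep_pair (outer V a b) x y"
    unfolding polygon_edges_nat_cyc by auto
  then have "x = a \<and> y = b \<or> \<not> sep_pair V x y"
    using sep_pair_outer[OF assms, of x y] by auto
  then show "d \<in> insert {a, b} (polygon_edges V nat_cyc)"
    using d pair_in_polygon_edges[of x y V] by auto
qed

lemma mem_polygon_dissection: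
  assumes "polygon_dissection V nat_cyc D" "d \<in> D"
  obtains x y where "d = {x, y}" "x < y" "sep_pair V x y"
  using assms unfolding polygon_dissection_def diagonals_nat_cyc sep_pair_def by blast

text \<open>Suppose \<open>S\<close> had vertices strictly on both sides. If \<open>a\<close> or
  \<open>b\<close> were missing, the edge of \<open>S\<close> passing over it would be a diagonal in
  \<open>D\<close> crossing \<open>{a, b}\<close>. If both are present, \<open>{a, b}\<close> is a
  diagonal of \<open>S\<close> lying in \<open>D\<close>.\<close>

lemma subpolygon_one_side:
  assumes "polygon_dissection V nat_cyc D" "{a, b} \<in> D" "a < b" "S \<in> subpolygons V nat_cyc D"
  shows "S \<subseteq> inner V a b \<or> S \<subseteq> outer V a b"
proof (rule ccontr)
  assume "\<not> ?thesis"
  moreover have SV: "S \<subseteq> V" and S3: "finite S" "3 \<le> card S"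
    and E: "polygon_edges S nat_cyc \<subseteq> polygon_edges V nat_cyc \<union> D" and dS: "diagonals S nat_cyc \<inter> D = {}"
    using assms(4) by (auto simp: subpolygons_def polygon_nat_cyc)
  ultimately obtain s t where s: "s \<in> S" "a < s" "s < b" and t: "t \<in> S" "t < a \<or> b < t"
    by (auto simp: not_le subset_iff)
  have S2: "2 \<le> card S" using S3 by simp
  have "{a, b} \<in> diagonals V nat_cyc" using assms(1,2) unfolding polygon_dissection_def by blast
  then have ab: "a \<in> V" "b \<in> V" using assms(3) pair_in_diagonals[of a b V] by (auto simp: sep_pair_def)
  have no_crossing: False if "x \<in> S" "y \<in> S" "\<not> sep_pair S x y"
    "x < a \<and> a < y \<and> y < b \<or> a < x \<and> x < b \<and> b < y" for x y
  proof -
    have xy: "x < y" using that(4) by auto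
    have "sep_pair V x y" using that SV ab xy unfolding sep_pair_def by blast
    then have "{x, y} \<in> D"
      using E that(1-3) xy pair_in_polygon_edges[of x y S] pair_in_polygon_edges[of x y V] by auto
    moreover have "crossing nat_cyc {x, y} {a, b}"
      using that(4) xy assms(3) crossing_nat_cyc[of x y a b] by auto
    ultimately show False using assms(1,2) unfolding polygon_dissection_def by blast
  qed
  have "a \<in> S"
  proof (rule ccontr)
    assume "a \<notin> S"
    then obtain x y where xy: "x \<in> S" "y \<in> S" "x < y" "\<not> sep_pair S x y"
      "(x < a \<and> a < y \<and> (\<forall>z\<in>S. z \<le> x \<or> y \<le> z)) \<or> ((a < x \<or> y < a) \<and> (\<forall>z\<in>S. x \<le> z \<and> z \<le> y))"
      using polygon_edge_over[OF S3(1) S2] by metis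
    \<comment> \<open>The vertices \<open>s\<close> and \<open>t\<close> on the two sides bound the
      gap around \<open>a\<close>, so its edge has one end strictly inside and one strictly
      outside.\<close>
    have "x < a \<and> a < y \<and> y < b \<or> a < x \<and> x < b \<and> b < y"
      using xy(5) s t by fastforce
    then show False using no_crossing[OF xy(1,2,4)] by blast
  qed
  moreover have "b \<in> S"
  proof (rule ccontr)
    assume "b \<notin> S"
    then obtain x y where xy: "x \<in> S" "y \<in> S" "x < y" "\<not> sep_pair S x y"
      "(x < b \<and> b < y \<and> (\<forall>z\<in>S. z \<le> x \<or> y \<le> z)) \<or> ((b < x \<or> y < b) \<and> (\<forall>z\<in>S. x \<le> z \<and> z \<le> y))"
      using polygon_edge_over[OF S3(1) S2] by metis
    have "x < a \<and> a < y \<and> y < b \<or> a < x \<and> x < b \<and> b < y"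
      using xy(5) s t by fastforce
    then show False using no_crossing[OF xy(1,2,4)] by blast
  qed
  ultimately have "sep_pair S a b" using s t assms(3) unfolding sep_pair_def by blast
  then show False using dS assms(2,3) pair_in_diagonals[of a b S] by blast
qed

text \<open>Each subpolygon lies on one side, and its defining conditions do not depend on whether
  they are read in \<open>V\<close> or in that side: the only new edge of a side is
  \<open>{a, b}\<close>, which belongs to \<open>D\<close>.\<close>

lemma subpolygons_cut:
  assumes D: "polygon_dissection V nat_cyc D" "{a, b} \<in> D" "a < b" and V: "finite V"
  shows "subpolygons V nat_cyc D =
    subpolygons (inner V a b) nat_cyc (D \<inter> diagonals (inner V a b) nat_cyc) \<union>
    subpolygons (outer V a b) nat_cyc (D \<inter> diagonals (outer V a b) nat_cyc)" (is "?L = ?I \<union> ?O")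
proof -
  have "{a, b} \<in> diagonals V nat_cyc" using D unfolding polygon_dissection_def by blast
  then have ab: "a \<in> V" "b \<in> V" using D(3) pair_in_diagonals[of a b V] by (auto simp: sep_pair_def)
  have up: "S \<in> ?L"
    if "S \<in> subpolygons W nat_cyc (D \<inter> diagonals W nat_cyc)" "W \<subseteq> V"
      "polygon_edges W nat_cyc \<subseteq> insert {a, b} (polygon_edges V nat_cyc)" for S W
    using that diagonals_mono[of S W] D(2) unfolding subpolygons_def by blast
  have down: "S \<in> subpolygons W nat_cyc (D \<inter> diagonals W nat_cyc)" if "S \<in> ?L" "S \<subseteq> W" "W \<subseteq> V" for S W
  proof -
    have "d \<in> polygon_edges W nat_cyc \<union> (D \<inter> diagonals W nat_cyc)" if d: "d \<in> polygon_edges S nat_cyc" for d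
    proof -
      have dW: "d \<subseteq> W" using d \<open>S \<subseteq> W\<close> unfolding polygon_edges_nat_cyc by blast
      have "d \<in> polygon_edges V nat_cyc \<or> d \<in> D" using d \<open>S \<in> ?L\<close> unfolding subpolygons_def by blast
      then show ?thesis
        using polygon_edges_restrict[OF \<open>W \<subseteq> V\<close> _ dW] pair_edge_or_diagonal[OF dW] D(1)
        unfolding polygon_dissection_def by blast
    qed
    then show ?thesis using that unfolding subpolygons_def by blast
  qed
  show ?thesis
  proof (intro equalityI subsetI)
    fix S assume "S \<in> ?L"
    then show "S \<in> ?I \<union> ?O"
      using subpolygon_one_side[OF D, of S] down[of S "inner V a b"] down[of S "outer V a b"] by blast
  next
    fix S assume "S \<in> ?I \<union> ?O"
    then show "S \<in> ?L"
      using up[of S "inner V a b"] up[of S "outer V a b"]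
        polygon_edges_inner[OF ab] polygon_edges_outer[OF ab D(3)] by blast
  qed
qed

text \<open>The sides share only \<open>a\<close> and \<open>b\<close>, too few vertices for a
  polygon; hence numbers of subpolygons add up over a cut.\<close>

lemma subpolygons_cut_disjoint:
  assumes "a < b"
  shows "subpolygons (inner V a b) nat_cyc D \<inter> subpolygons (outer V a b) nat_cyc E = {}"
proof -
  have "card S < 3" if "S \<subseteq> inner V a b" "S \<subseteq> outer V a b" for S
  proof -
    have "S \<subseteq> {a, b}" using that by (auto simp: subset_iff) (metis le_neq_implies_less)
    then have "card S \<le> card {a, b}" by (intro card_mono) auto
    then show ?thesis using assms by simp
  qed
  then have "\<not> (S \<subseteq> inner V a b \<and> S \<subseteq> outer V a b \<and> 3 \<le> card S)" for S
    using not_le by blast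
  then show ?thesis unfolding subpolygons_def polygon_nat_cyc by blast
qed

lemma polygon_dissection_restrict:
  assumes "polygon_dissection V nat_cyc D"
  shows "polygon_dissection W nat_cyc (D \<inter> diagonals W nat_cyc)"
  using assms unfolding polygon_dissection_def by blast

lemma p_angulation_cut:
  assumes "p_angulation p V nat_cyc D" "{a, b} \<in> D" "a < b" "finite V"
  shows "p_angulation p (inner V a b) nat_cyc (D \<inter> diagonals (inner V a b) nat_cyc)"
    and "p_angulation p (outer V a b) nat_cyc (D \<inter> diagonals (outer V a b) nat_cyc)"
  using assms polygon_dissection_restrict[of V D] subpolygons_cut[of V D a b]
  unfolding p_angulation_def by auto

text \<open>Not crossing \<open>{a, b}\<close> keeps every other diagonal on one side, where it is
  still a diagonal.\<close>

lemma dissection_cut: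
  assumes "polygon_dissection V nat_cyc D" "{a, b} \<in> D" "a < b"
  shows "D = insert {a, b} ((D \<inter> diagonals (inner V a b) nat_cyc) \<union> (D \<inter> diagonals (outer V a b) nat_cyc))"
proof -
  have "{a, b} \<in> diagonals V nat_cyc" using assms unfolding polygon_dissection_def by blast
  then have ab: "a \<in> V" "b \<in> V" using assms(3) pair_in_diagonals[of a b V] by (auto simp: sep_pair_def)
  have "d \<in> insert {a, b} (diagonals (inner V a b) nat_cyc \<union> diagonals (outer V a b) nat_cyc)"
    if d: "d \<in> D" for d
  proof -
    obtain x y where xy: "d = {x, y}" "x < y" "sep_pair V x y"
      using mem_polygon_dissection[OF assms(1) d] by blast
    have "\<not> crossing nat_cyc d {a, b}" using assms(1,2) d unfolding polygon_dissection_def by blast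
    then have nc: "\<not> (x < a \<and> a < y \<and> y < b \<or> a < x \<and> x < b \<and> b < y)"
      using crossing_nat_cyc[OF xy(2) assms(3)] xy(1) by simp
    have V: "x \<in> V" "y \<in> V" using xy(3) by (auto simp: sep_pair_def)
    consider "x = a" "y = b" | "a \<le> x" "y \<le> b" "\<not> (x = a \<and> y = b)"
      | "x \<in> outer V a b" "y \<in> outer V a b" "\<not> (x = a \<and> y = b)"
      using nc V xy(2) assms(3) by fastforce
    then show ?thesis
      using sep_pair_inner[OF ab xy(3)] sep_pair_outer[OF ab assms(3) xy(3)] xy(1,2)
        pair_in_diagonals[OF xy(2)] by cases auto
  qed
  then show ?thesis using assms(2) by blast
qed

text \<open>Diagonals on opposite sides do not cross, and the only chord common to both sides is
  \<open>{a, b}\<close>, an edge of each. So restricting the union to a side gives back its own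
  dissection, and \<open>subpolygons_cut\<close> applies.\<close>

lemma p_angulation_glue:
  assumes I: "p_angulation p (inner V a b) nat_cyc D" and O: "p_angulation p (outer V a b) nat_cyc E"
    and ab: "sep_pair V a b" and V: "finite V"
  shows "p_angulation p V nat_cyc (insert {a, b} (D \<union> E))"
    and "subpolygons V nat_cyc (insert {a, b} (D \<union> E)) =
      subpolygons (inner V a b) nat_cyc D \<union> subpolygons (outer V a b) nat_cyc E"
proof -
  let ?F = "insert {a, b} (D \<union> E)"
  have ab': "a < b" "a \<in> V" "b \<in> V" using ab by (auto simp: sep_pair_def)
  have dI: "polygon_dissection (inner V a b) nat_cyc D" and dO: "polygon_dissection (outer V a b) nat_cyc E"
    using I O unfolding p_angulation_def by auto
  have D: "\<exists>x y. d = {x, y} \<and> x < y \<and> a \<le> x \<and> y \<le> b \<and> sep_pair (inner V a b) x y" if d: "d \<in> D" for d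
  proof -
    obtain x y where "d = {x, y}" "x < y" "sep_pair (inner V a b) x y"
      by (rule mem_polygon_dissection[OF dI d])
    then show ?thesis unfolding sep_pair_def by auto
  qed
  have E: "\<exists>x y. d = {x, y} \<and> x < y \<and> (x \<le> a \<or> b \<le> x) \<and> (y \<le> a \<or> b \<le> y) \<and> sep_pair (outer V a b) x y" if d: "d \<in> E" for d
  proof -
    obtain x y where "d = {x, y}" "x < y" "sep_pair (outer V a b) x y"
      by (rule mem_polygon_dissection[OF dO d])
    moreover from this have "x \<le> a \<or> b \<le> x" "y \<le> a \<or> b \<le> y"
      unfolding sep_pair_def by auto
    ultimately show ?thesis by blast
  qed
  have DE: "\<not> crossing nat_cyc d e \<and> \<not> crossing nat_cyc e d" if d: "d \<in> insert {a, b} D" and e: "e \<in> insert {a, b} E" for d e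
  proof -
    obtain x y where d: "d = {x, y}" "x < y" "a \<le> x" "y \<le> b" using d D[of d] ab'(1) by (cases "d = {a, b}") blast+
    obtain z w where e: "e = {z, w}" "z < w" "z \<le> a \<or> b \<le> z" "w \<le> a \<or> b \<le> w" using e E[of e] ab'(1) by (cases "e = {a, b}") blast+
    show ?thesis
      using d e crossing_nat_cyc[of x y z w] crossing_nat_cyc[of z w x y] by auto
  qed
  have DD: "\<not> crossing nat_cyc d e" if "d \<in> D" "e \<in> D" for d e
    using I that unfolding p_angulation_def polygon_dissection_def by blast
  have EE: "\<not> crossing nat_cyc d e" if "d \<in> E" "e \<in> E" for d e
    using O that unfolding p_angulation_def polygon_dissection_def by blast
  have DEd: "D \<subseteq> diagonals (inner V a b) nat_cyc" "E \<subseteq> diagonals (outer V a b) nat_cyc"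
    using dI dO unfolding polygon_dissection_def by simp_all
  have "{a, b} \<in> diagonals V nat_cyc" using ab ab' pair_in_diagonals by blast
  moreover have "D \<subseteq> diagonals V nat_cyc" "E \<subseteq> diagonals V nat_cyc"
    using DEd diagonals_mono[OF Int_lower1] diagonals_mono[OF Diff_subset] by (meson subset_trans)+
  moreover have "\<not> crossing nat_cyc d e" if "d \<in> ?F" "e \<in> ?F" for d e
    using that DE[of d e] DE[of e d] DD[of d e] EE[of d e] by blast
  ultimately have dis: "polygon_dissection V nat_cyc ?F"
    unfolding polygon_dissection_def by simp
  have nI: "\<not> sep_pair (inner V a b) a b" and nO: "\<not> sep_pair (outer V a b) a b"
    by (auto simp: sep_pair_def)
  have "E \<inter> diagonals (inner V a b) nat_cyc = {}"
  proof (rule ccontr)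
    assume "\<not> ?thesis"
    then obtain d where d: "d \<in> E" "d \<in> diagonals (inner V a b) nat_cyc" by blast
    obtain x y where xy: "d = {x, y}" "x < y" "(x \<le> a \<or> b \<le> x) \<and> (y \<le> a \<or> b \<le> y)" using E[OF d(1)] by blast
    then have "sep_pair (inner V a b) x y" using d(2) pair_in_diagonals[of x y] by blast
    moreover from this have "x = a" "y = b" using xy unfolding sep_pair_def by auto
    ultimately show False using nI by blast
  qed
  moreover have "D \<inter> diagonals (outer V a b) nat_cyc = {}"
  proof (rule ccontr)
    assume "\<not> ?thesis"
    then obtain d where d: "d \<in> D" "d \<in> diagonals (outer V a b) nat_cyc" by blast
    obtain x y where xy: "d = {x, y}" "x < y" "a \<le> x" "y \<le> b" using D[OF d(1)] by blast
    then have "sep_pair (outer V a b) x y" using d(2) pair_in_diagonals[of x y] by blast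
    moreover from this have "x = a" "y = b" using xy unfolding sep_pair_def by auto
    ultimately show False using nO by blast
  qed
  moreover note DEd
  moreover have "{a, b} \<notin> diagonals (inner V a b) nat_cyc" "{a, b} \<notin> diagonals (outer V a b) nat_cyc"
    using nI nO pair_in_diagonals[OF ab'(1)] by blast+
  ultimately have "?F \<inter> diagonals (inner V a b) nat_cyc = D" "?F \<inter> diagonals (outer V a b) nat_cyc = E"
    by blast+
  then show *: "subpolygons V nat_cyc ?F = subpolygons (inner V a b) nat_cyc D \<union> subpolygons (outer V a b) nat_cyc E"
    using subpolygons_cut[OF dis _ ab'(1) V] by auto
  show "p_angulation p V nat_cyc ?F"
    using dis I O * unfolding p_angulation_def by auto
qed

section \<open>Neighbouring vertices\<close>

lemma next_vertex_nat_cyc: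
  "next_vertex V nat_cyc x y \<longleftrightarrow> x \<in> V \<and> y \<in> V \<and>
     (x < y \<and> (\<forall>z\<in>V. z \<le> x \<or> y \<le> z) \<or> y < x \<and> (\<forall>z\<in>V. y \<le> z \<and> z \<le> x))"
proof (cases x y rule: linorder_cases)
  case less
  then show ?thesis
    using nat_cyc_less(1)[OF less] unfolding next_vertex_def by (auto simp: not_less[symmetric])
next
  case greater
  then show ?thesis
    using nat_cyc_less(2)[OF greater] unfolding next_vertex_def by (auto simp: not_less[symmetric])
qed (simp add: next_vertex_def)

text \<open>The ranges are half open because at \<open>a\<close> only the successor lies inside, and
  at \<open>b\<close> only the predecessor. In \<open>next_vertex_outer\<close> the roles are
  exchanged.\<close>

lemma next_vertex_inner:
  assumes "sep_pair V a b" "next_vertex V nat_cyc x y"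
  shows "a < y \<Longrightarrow> y \<le> b \<Longrightarrow> next_vertex (inner V a b) nat_cyc x y"
    and "a \<le> x \<Longrightarrow> x < b \<Longrightarrow> next_vertex (inner V a b) nat_cyc x y"
proof -
  have ab: "a \<in> V" "b \<in> V" "a < b" using assms(1) unfolding sep_pair_def by auto
  have xy: "x \<in> V" "y \<in> V" "x < y \<and> (\<forall>z\<in>V. z \<le> x \<or> y \<le> z) \<or> y < x \<and> (\<forall>z\<in>V. y \<le> z \<and> z \<le> x)"
    using assms(2) unfolding next_vertex_nat_cyc by auto
  show "next_vertex (inner V a b) nat_cyc x y" if "a < y" "y \<le> b"
  proof -
    have "a \<le> x" "x < y" using xy ab that by fastforce+
    then show ?thesis using xy that unfolding next_vertex_nat_cyc by auto
  qed
  show "next_vertex (inner V a b) nat_cyc x y" if "a \<le> x" "x < b"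
  proof -
    have "y \<le> b" "x < y" using xy ab that by fastforce+
    then show ?thesis using xy that unfolding next_vertex_nat_cyc by auto
  qed
qed

lemma next_vertex_outer:
  assumes "sep_pair V a b" "next_vertex V nat_cyc x y"
  shows "y \<le> a \<or> b < y \<Longrightarrow> next_vertex (outer V a b) nat_cyc x y"
    and "x < a \<or> b \<le> x \<Longrightarrow> next_vertex (outer V a b) nat_cyc x y"
proof -
  have ab: "a \<in> V" "b \<in> V" "a < b" using assms(1) unfolding sep_pair_def by auto
  have xy: "x \<in> V" "y \<in> V" "x < y \<and> (\<forall>z\<in>V. z \<le> x \<or> y \<le> z) \<or> y < x \<and> (\<forall>z\<in>V. y \<le> z \<and> z \<le> x)"
    using assms(2) unfolding next_vertex_nat_cyc by auto
  show "next_vertex (outer V a b) nat_cyc x y" if "y \<le> a \<or> b < y"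
  proof -
    have "x < a \<or> b \<le> x" using xy ab that by fastforce
    then show ?thesis using xy that ab unfolding next_vertex_nat_cyc by auto
  qed
  show "next_vertex (outer V a b) nat_cyc x y" if "x < a \<or> b \<le> x"
  proof -
    have "y \<le> a \<or> b < y" using xy ab that by fastforce
    then show ?thesis using xy that ab unfolding next_vertex_nat_cyc by auto
  qed
qed

lemma next_vertex_cut:
  assumes "a \<in> V" "b \<in> V" "a < b"
  shows "next_vertex (inner V a b) nat_cyc b a" "next_vertex (outer V a b) nat_cyc a b"
  using assms unfolding next_vertex_nat_cyc by auto

lemma next_vertex_unique:
  assumes "next_vertex V nat_cyc x y"
  shows "next_vertex V nat_cyc x z \<Longrightarrow> y = z" "next_vertex V nat_cyc z y \<Longrightarrow> x = z"
  using assms unfolding next_vertex_nat_cyc by (metis leD le_antisym nat_less_le)+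

lemma next_vertex_exists:
  assumes "finite V" "x \<in> V" "y \<in> V" "x \<noteq> y"
  shows "\<exists>z. next_vertex V nat_cyc x z" "\<exists>z. next_vertex V nat_cyc z x"
proof -
  show "\<exists>z. next_vertex V nat_cyc x z"
  proof (cases "\<exists>z\<in>V. x < z")
    case True
    let ?m = "Min {z\<in>V. x < z}"
    have "?m \<in> {z\<in>V. x < z}" using True assms(1) by (intro Min_in) auto
    moreover have "?m \<le> z" if "z \<in> V" "x < z" for z using that assms(1) by (intro Min_le) auto
    ultimately have "next_vertex V nat_cyc x ?m"
      using assms(2) unfolding next_vertex_nat_cyc by (auto simp: not_less[symmetric])
    then show ?thesis ..
  next
    case False
    have "Min V \<in> V" using assms(1,2) by (intro Min_in) auto
    moreover have "Min V \<le> z" if "z \<in> V" for z using that assms(1) by simp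
    ultimately have "next_vertex V nat_cyc x (Min V)"
      using assms False unfolding next_vertex_nat_cyc by (metis le_neq_implies_less not_less)
    then show ?thesis ..
  qed
  show "\<exists>z. next_vertex V nat_cyc z x"
  proof (cases "\<exists>z\<in>V. z < x")
    case True
    let ?m = "Max {z\<in>V. z < x}"
    have "?m \<in> {z\<in>V. z < x}" using True assms(1) by (intro Max_in) auto
    moreover have "z \<le> ?m" if "z \<in> V" "z < x" for z using that assms(1) by (intro Max_ge) auto
    ultimately have "next_vertex V nat_cyc ?m x"
      using assms(2) unfolding next_vertex_nat_cyc by (auto simp: not_less[symmetric])
    then show ?thesis ..
  next
    case False
    have "Max V \<in> V" using assms(1,2) by (intro Max_in) auto
    moreover have "z \<le> Max V" if "z \<in> V" for z using that assms(1) by simp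
    ultimately have "next_vertex V nat_cyc (Max V) x"
      using assms False unfolding next_vertex_nat_cyc by (metis le_neq_implies_less not_less)
    then show ?thesis ..
  qed
qed

section \<open>Realizations by plane vectors\<close>

text \<open>The determinant of the matrix with columns \<open>u\<close> and
  \<open>w\<close>.\<close>

definition wedge :: "real \<times> real \<Rightarrow> real \<times> real \<Rightarrow> real" where
  "wedge u w = fst u * snd w - snd u * fst w"

lemma wedge_self [simp]: "wedge u u = 0"
  by (simp add: wedge_def)

lemma wedge_swap: "wedge u w = - wedge w u"
  by (simp add: wedge_def)

lemma wedge_pluecker: "wedge a c * wedge b d = wedge a b * wedge c d + wedge a d * wedge b c"
  unfolding wedge_def by algebra

text \<open>The order \<open>x < y\<close> fixes the sign also on the closing edge from the least to
  the greatest vertex; this is what makes the continuation around the polygon antiperiodic.\<close>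

definition realization :: "nat set \<Rightarrow> (nat \<Rightarrow> real \<times> real) \<Rightarrow> bool" where
  "realization V v \<longleftrightarrow> (\<forall>x\<in>V. \<forall>y\<in>V. x < y \<longrightarrow>
     0 < wedge (v x) (v y) \<and> (\<not> sep_pair V x y \<longrightarrow> wedge (v x) (v y) = 1))"

definition unit_diagonals :: "nat set \<Rightarrow> (nat \<Rightarrow> real \<times> real) \<Rightarrow> nat set set" where
  "unit_diagonals V v = {{x, y} | x y. sep_pair V x y \<and> wedge (v x) (v y) = 1}"

lemma realization_pos: "realization V v \<Longrightarrow> x \<in> V \<Longrightarrow> y \<in> V \<Longrightarrow> x < y \<Longrightarrow> 0 < wedge (v x) (v y)"
  unfolding realization_def by blast

lemma realization_edge:
  "realization V v \<Longrightarrow> x \<in> V \<Longrightarrow> y \<in> V \<Longrightarrow> x < y \<Longrightarrow> \<not> sep_pair V x y \<Longrightarrow> wedge (v x) (v y) = 1"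
  unfolding realization_def by blast

text \<open>The absolute value is there for the closing edge, which runs from the greatest vertex to
  the least and has wedge \<open>-1\<close>.\<close>

lemma realization_next:
  assumes "realization V v" "next_vertex V nat_cyc x y"
  shows "\<bar>wedge (v x) (v y)\<bar> = 1"
proof -
  have xy: "x \<in> V" "y \<in> V" "x < y \<and> \<not> sep_pair V x y \<or> y < x \<and> \<not> sep_pair V y x"
    using assms(2) unfolding next_vertex_nat_cyc sep_pair_def by fastforce+
  then show ?thesis
    using realization_edge[OF assms(1), of x y] realization_edge[OF assms(1), of y x] wedge_swap[of "v x" "v y"]
    by auto
qed

text \<open>The Ptolemy relation across a chord of wedge \<open>1\<close>. In a realization all
  terms on the right are positive for vertices in the order \<open>a, u, b, t\<close> in the first
  form, and \<open>t, a, u, b\<close> in the second.\<close>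

lemma wedge_cross:
  assumes "wedge a b = 1"
  shows "wedge u t = wedge a u * wedge b t + wedge a t * wedge u b"
    and "wedge t u = wedge t a * wedge u b + wedge t b * wedge a u"
  using wedge_pluecker[of a b u t] wedge_pluecker[of t u a b] assms by (auto simp: algebra_simps)

lemma realization_cut:
  assumes "realization V v" "sep_pair V a b" "wedge (v a) (v b) = 1"
  shows "realization (inner V a b) v" "realization (outer V a b) v"
proof -
  have ab: "a \<in> V" "b \<in> V" "a < b" using assms(2) unfolding sep_pair_def by auto
  show "realization (inner V a b) v"
    unfolding realization_def
  proof (intro ballI impI conjI)
    fix x y assume xy: "x \<in> inner V a b" "y \<in> inner V a b" "x < y"
    then show "0 < wedge (v x) (v y)" using realization_pos[OF assms(1)] by blast
    assume "\<not> sep_pair (inner V a b) x y"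
    then have "\<not> sep_pair V x y \<or> x = a \<and> y = b" using sep_pair_inner[OF ab(1,2), of x y] xy by auto
    then show "wedge (v x) (v y) = 1" using realization_edge[OF assms(1), of x y] xy assms(3) by blast
  qed
  show "realization (outer V a b) v"
    unfolding realization_def
  proof (intro ballI impI conjI)
    fix x y assume xy: "x \<in> outer V a b" "y \<in> outer V a b" "x < y"
    then show "0 < wedge (v x) (v y)" using realization_pos[OF assms(1)] by blast
    assume "\<not> sep_pair (outer V a b) x y"
    then have "\<not> sep_pair V x y \<or> x = a \<and> y = b" using sep_pair_outer[OF ab, of x y] xy by blast
    then show "wedge (v x) (v y) = 1" using realization_edge[OF assms(1), of x y] xy assms(3) by blast
  qed
qed

lemma same_side_or_cross:
  assumes "sep_pair V a b" "x \<in> V" "y \<in> V" "x < y"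
  obtains "x \<in> inner V a b" "y \<in> inner V a b"
    | "x \<in> outer V a b" "y \<in> outer V a b"
    | "a < x" "x < b" "b < y" "y \<in> V"
    | "x < a" "a < y" "y < b" "x \<in> V"
  using assms unfolding sep_pair_def by fastforce

lemma cut_wedge:
  assumes "sep_pair V a b" "realization (inner V a b) v" "realization (outer V a b) v"
  shows "wedge (v a) (v b) = 1"
  using realization_edge[OF assms(2), of a b] assms(1) unfolding sep_pair_def by auto

text \<open>Lower bounds survive gluing because the two products in the Ptolemy relation add up.\<close>

lemma wedge_glue_gt:
  assumes ab: "sep_pair V a b" and I: "realization (inner V a b) v" and O: "realization (outer V a b) v"
    and x: "u \<in> V" "a < u" "u < b" and c: "0 \<le> c"
    and bI: "\<And>x y. x \<in> inner V a b \<Longrightarrow> y \<in> inner V a b \<Longrightarrow> x < y \<Longrightarrow> c \<le> wedge (v x) (v y)"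
    and bO: "\<And>x y. x \<in> outer V a b \<Longrightarrow> y \<in> outer V a b \<Longrightarrow> x < y \<Longrightarrow> c \<le> wedge (v x) (v y)"
  shows "t \<in> V \<Longrightarrow> b < t \<Longrightarrow> 2 * (c * c) \<le> wedge (v u) (v t)" "t \<in> V \<Longrightarrow> b < t \<Longrightarrow> 0 < wedge (v u) (v t)"
    "t \<in> V \<Longrightarrow> t < a \<Longrightarrow> 2 * (c * c) \<le> wedge (v t) (v u)" "t \<in> V \<Longrightarrow> t < a \<Longrightarrow> 0 < wedge (v t) (v u)"
proof -
  have w: "wedge (v a) (v b) = 1" by (rule cut_wedge[OF ab I O])
  have V: "a \<in> V" "b \<in> V" "a < b" using ab unfolding sep_pair_def by auto
  have in1: "c \<le> wedge (v a) (v u)" "c \<le> wedge (v u) (v b)" using bI V x by auto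
  have in2: "0 < wedge (v a) (v u)" "0 < wedge (v u) (v b)"
    using realization_pos[OF I] V x by auto
  {
    assume t: "t \<in> V" "b < t"
    have out: "c \<le> wedge (v a) (v t)" "c \<le> wedge (v b) (v t)"  "0 < wedge (v a) (v t)" "0 < wedge (v b) (v t)"
      using bO realization_pos[OF O] V t by auto
    have "c * c \<le> wedge (v a) (v u) * wedge (v b) (v t)" "c * c \<le> wedge (v a) (v t) * wedge (v u) (v b)"
      using in1 in2 out c by (intro mult_mono; simp)+
    then show "2 * (c * c) \<le> wedge (v u) (v t)" unfolding wedge_cross(1)[OF w, of "v u" "v t"] by linarith
    show "0 < wedge (v u) (v t)" unfolding wedge_cross(1)[OF w, of "v u" "v t"]
      using in2 out by (intro add_pos_pos mult_pos_pos) auto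
  }
  {
    assume t: "t \<in> V" "t < a"
    have out: "c \<le> wedge (v t) (v a)" "c \<le> wedge (v t) (v b)"  "0 < wedge (v t) (v a)" "0 < wedge (v t) (v b)"
      using bO realization_pos[OF O] V t by auto
    have "c * c \<le> wedge (v t) (v a) * wedge (v u) (v b)" "c * c \<le> wedge (v t) (v b) * wedge (v a) (v u)"
      using in1 in2 out c by (intro mult_mono; simp)+
    then show "2 * (c * c) \<le> wedge (v t) (v u)" unfolding wedge_cross(2)[OF w, of "v t" "v u"] by linarith
    show "0 < wedge (v t) (v u)" unfolding wedge_cross(2)[OF w, of "v t" "v u"]
      using in2 out by (intro add_pos_pos mult_pos_pos) auto
  }
qed

text \<open>A chord across the cut is a diagonal, so only its positivity has to be shown;
  \<open>wedge_glue_gt\<close> with lower bound \<open>0\<close> gives it.\<close>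

lemma realization_glue:
  assumes ab: "sep_pair V a b" and I: "realization (inner V a b) v" and O: "realization (outer V a b) v"
  shows "realization V v"
  unfolding realization_def
proof (intro ballI impI)
  fix x y assume xy: "x \<in> V" "y \<in> V" "x < y"
  have V: "a \<in> V" "b \<in> V" "a < b" using ab unfolding sep_pair_def by auto
  have p: "0 \<le> wedge (v x) (v y)" if "x \<in> inner V a b \<and> y \<in> inner V a b \<or> x \<in> outer V a b \<and> y \<in> outer V a b" "x < y" for x y
    using realization_pos[OF I, of x y] realization_pos[OF O, of x y] that by auto
  note gt = wedge_glue_gt(2,4)[OF ab I O, of _ 0]
  from ab xy show "0 < wedge (v x) (v y) \<and> (\<not> sep_pair V x y \<longrightarrow> wedge (v x) (v y) = 1)"
  proof (cases rule: same_side_or_cross)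
    case 1
    then show ?thesis
      using realization_pos[OF I] realization_edge[OF I] xy(3) sep_pair_mono[of "inner V a b" x y V] by blast
  next
    case 2
    then show ?thesis
      using realization_pos[OF O] realization_edge[OF O] xy(3) sep_pair_mono[of "outer V a b" x y V] by blast
  next
    case 3
    moreover have "sep_pair V x y" using 3 V xy unfolding sep_pair_def by blast
    ultimately show ?thesis using gt(1)[of x y] p xy by auto
  next
    case 4
    moreover have "sep_pair V x y" using 4 V xy unfolding sep_pair_def by blast
    ultimately show ?thesis using gt(2)[of y x] p xy by auto
  qed
qed

text \<open>The neighbours of an end of the cut lie on different sides, so
  \<open>wedge_cross\<close> splits the wedge between them; the factors belonging to the edges at
  \<open>y\<close> are \<open>1\<close> up to sign.\<close>

lemma quiddity_cut:
  assumes "realization V v" "sep_pair V a b" "wedge (v a) (v b) = 1"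
    "next_vertex V nat_cyc x y" "next_vertex V nat_cyc y z"
  shows "y = a \<Longrightarrow> \<bar>wedge (v x) (v z)\<bar> = \<bar>wedge (v x) (v b)\<bar> + \<bar>wedge (v b) (v z)\<bar>"
    and "y = b \<Longrightarrow> \<bar>wedge (v x) (v z)\<bar> = \<bar>wedge (v x) (v a)\<bar> + \<bar>wedge (v a) (v z)\<bar>"
proof -
  have ab: "a \<in> V" "b \<in> V" "a < b" and bet: "\<exists>c\<in>V. a < c \<and> c < b" and out: "\<exists>c\<in>V. c < a \<or> b < c"
    using assms(2) unfolding sep_pair_def by auto
  have xz: "x \<in> V" "z \<in> V" using assms(4,5) unfolding next_vertex_def by auto
  have w: "\<bar>wedge (v x) (v y)\<bar> = 1" "\<bar>wedge (v y) (v z)\<bar> = 1"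
    using realization_next[OF assms(1)] assms(4,5) by auto
  note pos = realization_pos[OF assms(1)]
  {
    assume y: "y = a"
    have z: "a < z" "z < b"
      using assms(5) ab bet unfolding y next_vertex_nat_cyc by fastforce+
    have x: "x < a \<or> b < x"
      using assms(4) ab out unfolding y next_vertex_nat_cyc by fastforce
    have zp: "wedge (v a) (v z) = 1" "0 < wedge (v z) (v b)"
      using w(2) y pos[of a z] pos[of z b] ab xz z by auto
    \<comment> \<open>The predecessor of \<open>a\<close> comes before \<open>a\<close>, or after
      \<open>b\<close> by wrapping around when \<open>a\<close> is the least vertex.\<close>
    from x show "\<bar>wedge (v x) (v z)\<bar> = \<bar>wedge (v x) (v b)\<bar> + \<bar>wedge (v b) (v z)\<bar>"
    proof
      assume "x < a"
      then have "0 < wedge (v x) (v a)" "0 < wedge (v x) (v b)" "0 < wedge (v x) (v z)"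
        using pos ab xz z by auto
      then show ?thesis
        using wedge_cross(2)[OF assms(3), of "v x" "v z"] w(1) y zp wedge_swap[of "v b" "v z"] by auto
    next
      assume "b < x"
      then have "0 < wedge (v a) (v x)" "0 < wedge (v b) (v x)" "0 < wedge (v z) (v x)"
        using pos ab xz z by auto
      then show ?thesis
        using wedge_cross(1)[OF assms(3), of "v z" "v x"] w(1) y zp wedge_swap[of "v x" "v b"]
          wedge_swap[of "v b" "v z"] wedge_swap[of "v x" "v a"] wedge_swap[of "v x" "v z"] by auto
    qed
  }
  {
    assume y: "y = b"
    have x: "a < x" "x < b"
      using assms(4) ab bet unfolding y next_vertex_nat_cyc by fastforce+
    have z: "z < a \<or> b < z"
      using assms(5) ab out unfolding y next_vertex_nat_cyc by fastforce
    have xp: "wedge (v x) (v b) = 1" "0 < wedge (v a) (v x)"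
      using w(1) y pos[of x b] pos[of a x] ab xz x by auto
    from z show "\<bar>wedge (v x) (v z)\<bar> = \<bar>wedge (v x) (v a)\<bar> + \<bar>wedge (v a) (v z)\<bar>"
    proof
      assume "z < a"
      then have "0 < wedge (v z) (v a)" "0 < wedge (v z) (v b)" "0 < wedge (v z) (v x)"
        using pos ab xz x by auto
      then show ?thesis
        using wedge_cross(2)[OF assms(3), of "v z" "v x"] w(2) y xp wedge_swap[of "v x" "v a"]
          wedge_swap[of "v a" "v z"] wedge_swap[of "v x" "v z"] wedge_swap[of "v b" "v z"] by auto
    next
      assume "b < z"
      then have "0 < wedge (v a) (v z)" "0 < wedge (v b) (v z)" "0 < wedge (v x) (v z)"
        using pos ab xz x by auto
      then show ?thesis
        using wedge_cross(1)[OF assms(3), of "v x" "v z"] w(2) y xp wedge_swap[of "v x" "v a"] by auto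
    qed
  }
qed

section \<open>Angulated realizations\<close>

text \<open>The invariant of both inductions. The bound \<open>1\<close> forces entries across a cut
  to be at least \<open>2\<close>, so that gluing creates no further unit diagonals; the quiddity
  clause lets the unit diagonals determine the frieze.\<close>

definition angulated :: "nat \<Rightarrow> nat set \<Rightarrow> (nat \<Rightarrow> real \<times> real) \<Rightarrow> bool" where
  "angulated p V v \<longleftrightarrow> realization V v \<and> p_angulation p V nat_cyc (unit_diagonals V v) \<and>
     (\<forall>x\<in>V. \<forall>y\<in>V. x < y \<longrightarrow> 1 \<le> wedge (v x) (v y)) \<and>
     (\<forall>x y z. next_vertex V nat_cyc x y \<longrightarrow> next_vertex V nat_cyc y z \<longrightarrow>
        \<bar>wedge (v x) (v z)\<bar> =
        frieze_lambda p * real (card {S \<in> subpolygons V nat_cyc (unit_diagonals V v). y \<in> S}))"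

lemma finite_subpolygons: "finite V \<Longrightarrow> finite (subpolygons V cyc D)"
  unfolding subpolygons_def by (rule finite_subset[of _ "Pow V"]) auto

text \<open>By \<open>wedge_glue_gt\<close> with \<open>c = 1\<close> a chord across the cut has
  wedge at least \<open>2\<close>, so every unit diagonal other than the cut lies on one
  side.\<close>

lemma unit_diagonals_glue:
  assumes ab: "sep_pair V a b" and I: "realization (inner V a b) v" and O: "realization (outer V a b) v"
    and bI: "\<And>x y. x \<in> inner V a b \<Longrightarrow> y \<in> inner V a b \<Longrightarrow> x < y \<Longrightarrow> 1 \<le> wedge (v x) (v y)"
    and bO: "\<And>x y. x \<in> outer V a b \<Longrightarrow> y \<in> outer V a b \<Longrightarrow> x < y \<Longrightarrow> 1 \<le> wedge (v x) (v y)"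
  shows "unit_diagonals V v =
    insert {a, b} (unit_diagonals (inner V a b) v \<union> unit_diagonals (outer V a b) v)" (is "?L = ?R")
    and "x \<in> V \<Longrightarrow> y \<in> V \<Longrightarrow> x < y \<Longrightarrow> 1 \<le> wedge (v x) (v y)"
proof -
  have w: "wedge (v a) (v b) = 1" by (rule cut_wedge[OF ab I O])
  have V: "a \<in> V" "b \<in> V" "a < b" using ab unfolding sep_pair_def by auto
  have gt: "2 \<le> wedge (v x) (v y)" if "a < x \<and> x < b \<and> b < y \<or> x < a \<and> a < y \<and> y < b" "x \<in> V" "y \<in> V" for x y
    using wedge_glue_gt(1)[OF ab I O, of x 1 y] wedge_glue_gt(3)[OF ab I O, of y 1 x] bI bO that by auto
  show "1 \<le> wedge (v x) (v y)" if xy: "x \<in> V" "y \<in> V" "x < y" for x y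
    using ab xy
  proof (cases rule: same_side_or_cross)
    case 3
    then show ?thesis using gt[of x y] xy by simp
  next
    case 4
    then show ?thesis using gt[of x y] xy by simp
  qed (use bI bO xy in blast)+
  show "?L = ?R"
  proof (intro equalityI subsetI)
    fix d assume "d \<in> ?L"
    then obtain x y where d: "d = {x, y}" "sep_pair V x y" "wedge (v x) (v y) = 1"
      unfolding unit_diagonals_def by auto
    then have xy: "x \<in> V" "y \<in> V" "x < y" by (auto simp: sep_pair_def)
    from ab xy show "d \<in> ?R"
    proof (cases rule: same_side_or_cross)
      case 1
      then have "x = a \<and> y = b \<or> sep_pair (inner V a b) x y"
        using sep_pair_inner[OF V(1,2) d(2)] by auto
      then show ?thesis using d unfolding unit_diagonals_def by blast
    next
      case 2
      then have "x = a \<and> y = b \<or> sep_pair (outer V a b) x y"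
        using sep_pair_outer[OF V d(2)] by blast
      then show ?thesis using d unfolding unit_diagonals_def by blast
    next
      case 3
      then show ?thesis using gt[of x y] xy d(3) by simp
    next
      case 4
      then show ?thesis using gt[of x y] xy d(3) by simp
    qed
  next
    fix d assume "d \<in> ?R"
    then show "d \<in> ?L"
      using ab w sep_pair_mono[of "inner V a b" _ _ V] sep_pair_mono[of "outer V a b" _ _ V]
      unfolding unit_diagonals_def by blast
  qed
qed

text \<open>The subpolygons of \<open>V\<close> are the disjoint union of those of the two sides, so
  at the ends of the cut their numbers add up exactly as the quiddities do.\<close>

lemma angulated_glue:
  assumes ab: "sep_pair V a b" and I: "angulated p (inner V a b) v" and O: "angulated p (outer V a b) v"
    and V: "finite V"
  shows "angulated p V v"
    and "unit_diagonals V v =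
      insert {a, b} (unit_diagonals (inner V a b) v \<union> unit_diagonals (outer V a b) v)"
proof -
  let ?I = "inner V a b" and ?O = "outer V a b"
  have rI: "realization ?I v" and pI: "p_angulation p ?I nat_cyc (unit_diagonals ?I v)"
    and bI: "\<And>x y. x \<in> ?I \<Longrightarrow> y \<in> ?I \<Longrightarrow> x < y \<Longrightarrow> 1 \<le> wedge (v x) (v y)"
    and qI: "\<And>x y z. next_vertex ?I nat_cyc x y \<Longrightarrow> next_vertex ?I nat_cyc y z \<Longrightarrow>
        \<bar>wedge (v x) (v z)\<bar> =
        frieze_lambda p * real (card {S \<in> subpolygons ?I nat_cyc (unit_diagonals ?I v). y \<in> S})"
    using I unfolding angulated_def by auto
  have rO: "realization ?O v" and pO: "p_angulation p ?O nat_cyc (unit_diagonals ?O v)"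
    and bO: "\<And>x y. x \<in> ?O \<Longrightarrow> y \<in> ?O \<Longrightarrow> x < y \<Longrightarrow> 1 \<le> wedge (v x) (v y)"
    and qO: "\<And>x y z. next_vertex ?O nat_cyc x y \<Longrightarrow> next_vertex ?O nat_cyc y z \<Longrightarrow>
        \<bar>wedge (v x) (v z)\<bar> =
        frieze_lambda p * real (card {S \<in> subpolygons ?O nat_cyc (unit_diagonals ?O v). y \<in> S})"
    using O unfolding angulated_def by auto
  have ab': "a \<in> V" "b \<in> V" "a < b" using ab unfolding sep_pair_def by auto
  have w: "wedge (v a) (v b) = 1" by (rule cut_wedge[OF ab rI rO])
  have r: "realization V v" by (rule realization_glue[OF ab rI rO])
  show u: "unit_diagonals V v = insert {a, b} (unit_diagonals ?I v \<union> unit_diagonals ?O v)"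
    by (rule unit_diagonals_glue(1)[OF ab rI rO bI bO])
  have pV: "p_angulation p V nat_cyc (unit_diagonals V v)"
    unfolding u by (rule p_angulation_glue(1)[OF pI pO ab V])
  have sub: "subpolygons V nat_cyc (unit_diagonals V v) =
      subpolygons ?I nat_cyc (unit_diagonals ?I v) \<union> subpolygons ?O nat_cyc (unit_diagonals ?O v)"
    unfolding u by (rule p_angulation_glue(2)[OF pI pO ab V])
  define cV where "cV y = card {S \<in> subpolygons V nat_cyc (unit_diagonals V v). y \<in> S}" for y
  define cI where "cI y = card {S \<in> subpolygons ?I nat_cyc (unit_diagonals ?I v). y \<in> S}" for y
  define cO where "cO y = card {S \<in> subpolygons ?O nat_cyc (unit_diagonals ?O v). y \<in> S}" for y
  have count: "cV y = cI y + cO y" for y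
  proof -
    let ?SI = "{S \<in> subpolygons ?I nat_cyc (unit_diagonals ?I v). y \<in> S}"
    let ?SO = "{S \<in> subpolygons ?O nat_cyc (unit_diagonals ?O v). y \<in> S}"
    have "{S \<in> subpolygons V nat_cyc (unit_diagonals V v). y \<in> S} = ?SI \<union> ?SO"
      unfolding sub by blast
    moreover have "finite ?SI" "finite ?SO" using V by (simp_all add: finite_subpolygons)
    moreover have "?SI \<inter> ?SO = {}" using subpolygons_cut_disjoint[OF ab'(3)] by blast
    ultimately show ?thesis unfolding cV_def cI_def cO_def by (simp add: card_Un_disjoint)
  qed
  have cI0: "cI y = 0" if "y \<notin> ?I" for y
  proof -
    have "{S \<in> subpolygons ?I nat_cyc (unit_diagonals ?I v). y \<in> S} = {}"
      using that unfolding subpolygons_def by blast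
    then show ?thesis unfolding cI_def by (simp only: card.empty)
  qed
  have cO0: "cO y = 0" if "y \<notin> ?O" for y
  proof -
    have "{S \<in> subpolygons ?O nat_cyc (unit_diagonals ?O v). y \<in> S} = {}"
      using that unfolding subpolygons_def by blast
    then show ?thesis unfolding cO_def by (simp only: card.empty)
  qed
  have "\<bar>wedge (v x) (v z)\<bar> = frieze_lambda p * real (cV y)"
    if xy: "next_vertex V nat_cyc x y" and yz: "next_vertex V nat_cyc y z" for x y z
  proof -
    note nI = next_vertex_inner[OF ab xy] next_vertex_inner[OF ab yz]
    note nO = next_vertex_outer[OF ab xy] next_vertex_outer[OF ab yz]
    note cut = next_vertex_cut[OF ab']
    have yV: "y \<in> V" using xy by (simp add: next_vertex_def)
    \<comment> \<open>Away from the cut both neighbours of \<open>y\<close> lie on the side of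
      \<open>y\<close>, and the other side contributes no subpolygon.\<close>
    consider "a < y \<and> y < b" | "y < a \<or> b < y" | "y = a" | "y = b" by linarith
    then show ?thesis
    proof cases
      case 1
      then show ?thesis using qI[of x y z] nI cO0[of y] count[of y] by (simp add: cI_def)
    next
      case 2
      then have "next_vertex ?O nat_cyc x y" "next_vertex ?O nat_cyc y z" using nO by auto
      moreover have "y \<notin> ?I" using 2 by auto
      ultimately show ?thesis using qO[of x y z] cI0[of y] count[of y] by (simp add: cO_def)
    next
      case 3
      \<comment> \<open>In the outer polygon \<open>b\<close> follows \<open>a\<close>, in the inner
        one \<open>b\<close> precedes \<open>a\<close>; so both wedges with \<open>b\<close> are
        quiddities of the sides.\<close>
      have "\<bar>wedge (v x) (v b)\<bar> = frieze_lambda p * real (cO y)"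
        using qO[of x y b] cut nO 3 by (simp add: cO_def)
      moreover have "\<bar>wedge (v b) (v z)\<bar> = frieze_lambda p * real (cI y)"
        using qI[of b y z] cut nI 3 ab' by (simp add: cI_def)
      ultimately show ?thesis
        using quiddity_cut(1)[OF r ab w xy yz 3] count[of y] by (simp add: algebra_simps)
    next
      case 4
      have "\<bar>wedge (v x) (v a)\<bar> = frieze_lambda p * real (cI y)"
        using qI[of x y a] cut nI 4 ab' by (simp add: cI_def)
      moreover have "\<bar>wedge (v a) (v z)\<bar> = frieze_lambda p * real (cO y)"
        using qO[of a y z] cut nO 4 by (simp add: cO_def)
      ultimately show ?thesis
        using quiddity_cut(2)[OF r ab w xy yz 4] count[of y] by (simp add: algebra_simps)
    qed
  qed
  then show "angulated p V v"
    using r pV unit_diagonals_glue(2)[OF ab rI rO bI bO] unfolding angulated_def cV_def by blast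
qed

section \<open>Regular polygons and ears\<close>

text \<open>For \<open>k \<le> p\<close> the length of a chord over \<open>k\<close> sides of the
  regular \<open>p\<close>-gon with side length \<open>1\<close>.\<close>

definition chord :: "nat \<Rightarrow> nat \<Rightarrow> real" where
  "chord p k = sin (real k * (pi / real p)) / sin (pi / real p)"

lemma chord_0 [simp]: "chord p 0 = 0"
  by (simp add: chord_def)

text \<open>The Pluecker relation over two consecutive unit edges becomes a three-term recurrence
  whose coefficient is the quiddity \<open>wedge a c\<close>.\<close>

lemma wedge_rec:
  assumes "wedge a b = 1" "wedge b c = 1"
  shows "wedge x c = wedge a c * wedge x b - wedge x a"
  using wedge_pluecker[of x b a c] assms by (simp add: algebra_simps)

context
  fixes p :: nat
  assumes p3: "3 \<le> p"
begin

lemma sin_pi_div_pos: "0 < sin (pi / real p)"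
  using p3 by (intro sin_gt_zero) (auto simp: field_simps)

lemma chord_1 [simp]: "chord p (Suc 0) = 1"
  using sin_pi_div_pos by (simp add: chord_def)

lemma chord_rec: "chord p (k + 2) = frieze_lambda p * chord p (k + 1) - chord p k"
proof -
  have "sin (real (k + 2) * t) + sin (real k * t) = 2 * cos t * sin (real (k + 1) * t)" for t
  proof -
    have "real (k + 2) * t = real (k + 1) * t + t" "real k * t = real (k + 1) * t - t"
      by (simp_all add: algebra_simps)
    then show ?thesis by (simp only: sin_add sin_diff) (simp add: algebra_simps)
  qed
  from this[of "pi / real p"] show ?thesis
    using sin_pi_div_pos unfolding chord_def frieze_lambda_def by (simp add: field_simps)
qed

lemma chord_2: "chord p 2 = frieze_lambda p"
  using chord_rec[of 0] by (simp add: numeral_2_eq_2)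

lemma chord_symmetric:
  assumes "k \<le> p"
  shows "chord p (p - k) = chord p k"
proof -
  have "real (p - k) * (pi / real p) = pi - real k * (pi / real p)"
    using assms p3 by (simp add: of_nat_diff field_simps)
  then show ?thesis unfolding chord_def by simp
qed

text \<open>The bounds put \<open>k * pi / p\<close> strictly between \<open>pi / p\<close> and
  \<open>pi - pi / p\<close>, where the sine exceeds \<open>sin (pi / p)\<close>; this is seen by
  writing the difference of sines as a product.\<close>

lemma chord_gt_1:
  assumes "2 \<le> k" "k + 2 \<le> p"
  shows "1 < chord p k"
proof -
  let ?t = "pi / real p"
  have t: "0 < ?t" "real k * ?t + ?t < pi" "?t < real k * ?t"
  proof -
    show "0 < ?t" using p3 by simp
    have "real k * ?t + ?t = real (k + 1) * ?t" by (simp add: distrib_right add_divide_distrib)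
    also have "\<dots> < real p * ?t" using assms p3 by (intro mult_strict_right_mono) auto
    finally show "real k * ?t + ?t < pi" using p3 by simp
    have "1 * ?t < real k * ?t" using assms p3 by (intro mult_strict_right_mono) auto
    then show "?t < real k * ?t" by simp
  qed
  have "sin t < sin u" if "0 < t" "u + t < pi" "t < u" for t u :: real
  proof -
    have "0 < (u - t) / 2" "(u - t) / 2 < pi" "0 < (u + t) / 2" "(u + t) / 2 < pi / 2"
    proof -
      have "u - t < 2 * pi" using that pi_gt_zero by linarith
      then show "(u - t) / 2 < pi" by simp
    qed (use that in simp_all)
    then have "0 < 2 * sin ((u - t) / 2) * cos ((u + t) / 2)"
      by (intro mult_pos_pos sin_gt_zero cos_gt_zero) auto
    then show ?thesis using sin_diff_sin[of u t] by linarith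
  qed
  from this[OF t] have "sin ?t < sin (real k * ?t)" .
  then show ?thesis using sin_pi_div_pos unfolding chord_def by (simp add: field_simps)
qed

lemma chord_end: "chord p (p - 1) = 1"
  using chord_symmetric[of 1] p3 by simp

lemma chord_ge_1:
  assumes "0 < k" "k < p"
  shows "1 \<le> chord p k"
proof -
  consider "k = 1" | "k = p - 1" | "2 \<le> k" "k + 2 \<le> p" using assms by linarith
  then show ?thesis using chord_gt_1[of k] chord_end by cases auto
qed

lemma frieze_lambda_ge_1: "1 \<le> frieze_lambda p"
  using chord_ge_1[of 2] chord_2 p3 by simp

lemma chord_nonneg: "k \<le> p \<Longrightarrow> 0 \<le> chord p k"
  using chord_ge_1[of k] chord_symmetric[of 0] by (cases "k = 0"; cases "k = p") auto

text \<open>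
  While no \<open>p - 2\<close> consecutive quiddities equal \<open>\<lambda>\<close>, the quotients of consecutive entries
  \<open>wedge (w 0) (w i)\<close> stay above those of the regular \<open>p\<close>-gon, read off \<open>j + 1\<close> steps after
  its start, where \<open>j\<close> counts the quiddities \<open>\<lambda>\<close> met since the last larger one.
  Hence the entries could not come back to \<open>1\<close> at the end of the row.
\<close>

lemma lambda_run_exists:
  fixes w :: "nat \<Rightarrow> real \<times> real"
  assumes N: "3 \<le> N"
    and adj: "\<And>i. Suc i < N \<Longrightarrow> wedge (w i) (w (Suc i)) = 1"
    and pos: "\<And>i j. i < j \<Longrightarrow> j < N \<Longrightarrow> 0 < wedge (w i) (w j)"
    and closed: "wedge (w 0) (w (N - 1)) = 1"
    and quid: "\<And>i. i + 2 < N \<Longrightarrow> wedge (w i) (w (i + 2)) = frieze_lambda p \<or> 2 * frieze_lambda p \<le> wedge (w i) (w (i + 2))"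
    and last: "frieze_lambda p \<le> wedge (w 0) (w (N - 2))"
  shows "\<exists>t. t + p \<le> N \<and> (\<forall>k. t \<le> k \<and> k + 2 < t + p \<longrightarrow> wedge (w k) (w (k + 2)) = frieze_lambda p)"
proof -
  define u where "u i = wedge (w 0) (w i)" for i
  define q where "q i = wedge (w i) (w (i + 2))" for i
  let ?l = "frieze_lambda p" and ?s = "chord p"
  have rec: "u (i + 2) = q i * u (i + 1) - u i" if "i + 2 < N" for i
    using wedge_rec[of "w i" "w (i + 1)" "w (i + 2)" "w 0"] adj[of i] adj[of "Suc i"] that
    unfolding u_def q_def by simp
  have u_pos: "0 < u (Suc i)" if "Suc i < N" for i
    using pos[of 0 "Suc i"] that unfolding u_def by simp
  have u_nonneg: "0 \<le> u i" if "i < N" for i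
    using u_pos[of "i - 1"] that by (cases i) (auto simp: u_def)
  \<comment> \<open>The invariant says \<open>u (i + 1) / u i > ?s (j + 2) / ?s (j + 1)\<close>,
    multiplied out because \<open>u 0 = 0\<close>.\<close>
  have "(\<exists>t. t + p \<le> i + 2 \<and> (\<forall>k. t \<le> k \<and> k + 2 < t + p \<longrightarrow> q k = ?l)) \<or>
    (\<exists>j. j + 3 \<le> p \<and> j \<le> i \<and> (\<forall>k. i - j \<le> k \<and> k < i \<longrightarrow> q k = ?l) \<and> u i * ?s (j + 2) < u (i + 1) * ?s (j + 1))"
    (is "?run i \<or> ?inv i") if "i + 1 < N" for i
    using that
  proof (induction i)
    case 0
    have "?inv 0" using p3 u_pos[of 0] N by (intro exI[of _ 0]) (auto simp: u_def)
    then show ?case ..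
  next
    case (Suc i)
    then consider "?run i" | "?inv i" by auto
    then show ?case
    proof cases
      case 1
      then obtain t where "t + p \<le> i + 2" "\<forall>k. t \<le> k \<and> k + 2 < t + p \<longrightarrow> q k = ?l" by blast
      then have "?run (Suc i)" by (intro exI[of _ t]) auto
      then show ?thesis ..
    next
      case 2
      then obtain j where j: "j + 3 \<le> p" "j \<le> i" "\<And>k. i - j \<le> k \<Longrightarrow> k < i \<Longrightarrow> q k = ?l"
        "u i * ?s (j + 2) < u (i + 1) * ?s (j + 1)" by auto
      have i: "i + 2 < N" using Suc.prems by simp
      have s1: "0 < ?s (j + 1)" and s2: "0 < ?s (j + 2)" and s3: "0 \<le> ?s (j + 3)"
        using chord_ge_1[of "j + 1"] chord_ge_1[of "j + 2"] chord_nonneg[of "j + 3"] j(1) by auto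
      have s_rec: "?s (j + 3) = ?l * ?s (j + 2) - ?s (j + 1)"
        using chord_rec[of "j + 1"] by (simp add: numeral_3_eq_3)
      from quid[OF i] consider "q i = ?l" | "2 * ?l \<le> q i" unfolding q_def by auto
      then show ?thesis
      proof cases
        case 1
        have run: "q k = ?l" if "i - j \<le> k" "k < Suc i" for k
          using that j(3)[of k] 1 by (cases "k = i") auto
        show ?thesis
        \<comment> \<open>The \<open>j\<close> earlier quiddities and \<open>q i\<close> make
          \<open>j + 1\<close> in a row, so \<open>j + 3 = p\<close> completes the run.\<close>
        proof (cases "j + 3 = p")
          case True
          then have "?run (Suc i)" using j(2) run by (intro exI[of _ "i - j"]) auto
          then show ?thesis ..
        next
          case False
          have "u (i + 1) * ?s (j + 3) < u (i + 2) * ?s (j + 2)"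
            using j(4) unfolding rec[OF i] s_rec 1 by (simp add: algebra_simps)
          then have "?inv (Suc i)"
            using False j(1,2) run by (intro exI[of _ "Suc j"]) (auto simp: numeral_eq_Suc)
          then show ?thesis ..
        qed
      next
        case 2
        \<comment> \<open>Since \<open>?s (j + 3)\<close> is nonnegative, the invariant implies
          \<open>u i < ?l * u (i + 1)\<close>. A quiddity of at least \<open>2 * ?l\<close> then
          leaves \<open>u (i + 2) > ?l * u (i + 1)\<close>, which is the invariant for
          \<open>j = 0\<close>.\<close>
        have "u i * ?s (j + 1) \<le> u i * (?l * ?s (j + 2))"
          using s3 s_rec u_nonneg[of i] i by (intro mult_left_mono) auto
        also have "\<dots> < ?l * (u (i + 1) * ?s (j + 1))"
          using j(4) frieze_lambda_ge_1 by (simp add: mult.left_commute)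
        finally have "u i < ?l * u (i + 1)" using s1 by simp
        moreover have "2 * ?l * u (i + 1) \<le> q i * u (i + 1)"
          using 2 u_nonneg[of "i + 1"] i by (intro mult_right_mono) auto
        ultimately have "u (i + 1) * ?l < u (i + 2)" unfolding rec[OF i] by (simp add: algebra_simps)
        then have "?inv (Suc i)"
          using p3 chord_2 by (intro exI[of _ 0]) (auto simp: numeral_2_eq_2)
        then show ?thesis ..
      qed
    qed
  qed
  from this[of "N - 2"] N have "?run (N - 2) \<or> ?inv (N - 2)" by simp
  then show ?thesis
  proof
    assume "?run (N - 2)"
    moreover have "N - 2 + 2 = N" using N by simp
    ultimately show ?thesis unfolding q_def by (simp only:)
  next
    assume "?inv (N - 2)"
    then obtain j where j: "j + 3 \<le> p" "u (N - 2) * ?s (j + 2) < u (N - 2 + 1) * ?s (j + 1)" by blast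
    \<comment> \<open>With \<open>u (N - 1) = 1\<close> the invariant gives
      \<open>u (N - 2) < ?l\<close>, against the bound \<open>last\<close>.\<close>
    have "u (N - 2 + 1) = 1" using closed N unfolding u_def by (simp add: Suc_diff_Suc numeral_2_eq_2)
    moreover have "?s (j + 3) = ?l * ?s (j + 2) - ?s (j + 1)" "0 \<le> ?s (j + 3)"
      using chord_rec[of "j + 1"] chord_nonneg[of "j + 3"] j(1) by (simp_all add: numeral_3_eq_3)
    ultimately have "u (N - 2) * ?s (j + 2) < ?l * ?s (j + 2)" using j(2) by simp
    moreover have "0 < ?s (j + 2)" using chord_ge_1[of "j + 2"] j(1) by simp
    ultimately show ?thesis using last unfolding u_def by simp
  qed
qed

text \<open>For fixed \<open>i\<close> both sides satisfy the same recurrence in \<open>k\<close>,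
  with coefficient \<open>frieze_lambda p\<close> and initial values \<open>0\<close> and
  \<open>1\<close>.\<close>

lemma lambda_run_wedge:
  fixes w :: "nat \<Rightarrow> real \<times> real"
  assumes adj: "\<And>i. Suc i < p \<Longrightarrow> wedge (w i) (w (Suc i)) = 1"
    and run: "\<And>i. i + 2 < p \<Longrightarrow> wedge (w i) (w (i + 2)) = frieze_lambda p"
    and "i + k < p"
  shows "wedge (w i) (w (i + k)) = chord p k"
  using assms(3)
proof (induction k rule: less_induct)
  case (less k)
  consider "k = 0" | "k = 1" | l where "k = l + 2"
    by (metis One_nat_def add_2_eq_Suc' not0_implies_Suc)
  then show ?case
  proof cases
    case 3
    have "wedge (w i) (w (i + l + 2)) = frieze_lambda p * wedge (w i) (w (i + (l + 1))) - wedge (w i) (w (i + l))"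
      using wedge_rec[of "w (i + l)" "w (i + l + 1)" "w (i + l + 2)" "w i"]
        adj[of "i + l"] adj[of "i + l + 1"] run[of "i + l"] less.prems 3 by simp
    then show ?thesis
      using less.IH[of l] less.IH[of "l + 1"] less.prems 3 chord_rec[of l] by (simp add: add.assoc)
  qed (use adj[of i] less.prems in auto)
qed

end

section \<open>Increasing enumerations of vertex sets\<close>

context
  fixes e :: "nat \<Rightarrow> nat" and N :: nat and V :: "nat set"
  assumes mono: "strict_mono_on {..<N} e" and V: "V = e ` {..<N}"
begin

lemma enum_less: "i < N \<Longrightarrow> j < N \<Longrightarrow> e i < e j \<longleftrightarrow> i < j"
  using strict_mono_on_less[OF mono] by simp

lemma enum_le: "i < N \<Longrightarrow> j < N \<Longrightarrow> e i \<le> e j \<longleftrightarrow> i \<le> j"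
  using enum_less[of j i] by (simp add: linorder_not_less[symmetric])

lemma card_enum: "card V = N"
  unfolding V using strict_mono_on_imp_inj_on[OF mono] by (simp add: card_image)

lemma sep_pair_enum:
  assumes "i < N" "j < N"
  shows "sep_pair V (e i) (e j) \<longleftrightarrow> i + 2 \<le> j \<and> (0 < i \<or> j + 1 < N)"
proof -
  have "(\<exists>k<N. i < k \<and> k < j) \<longleftrightarrow> i + 2 \<le> j"
    using assms by (auto intro!: exI[of _ "i + 1"])
  moreover have "(\<exists>k<N. k < i \<or> j < k) \<longleftrightarrow> 0 < i \<or> j + 1 < N"
    using assms by (metis Suc_eq_plus1 gr0I lessI less_trans_Suc not_less_zero less_Suc_eq_0_disj le_less_trans not_less)
  ultimately show ?thesis
    using assms unfolding sep_pair_def V by (auto simp: enum_less)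
qed

lemma next_vertex_enum:
  assumes "i < N" "j < N" "2 \<le> N"
  shows "next_vertex V nat_cyc (e i) (e j) \<longleftrightarrow> j = Suc i \<or> j = 0 \<and> i = N - 1"
proof -
  have "next_vertex V nat_cyc (e i) (e j) \<longleftrightarrow>
      i < j \<and> (\<forall>k<N. k \<le> i \<or> j \<le> k) \<or> j < i \<and> (\<forall>k<N. j \<le> k \<and> k \<le> i)"
    using assms unfolding next_vertex_nat_cyc V by (simp add: enum_less enum_le) blast
  also have "i < j \<and> (\<forall>k<N. k \<le> i \<or> j \<le> k) \<longleftrightarrow> j = Suc i"
    using assms by (metis Suc_leI le_antisym lessI not_less le_less_trans less_Suc_eq_le)
  also have "j < i \<and> (\<forall>k<N. j \<le> k \<and> k \<le> i) \<longleftrightarrow> j = 0 \<and> i = N - 1"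
  proof
    assume "j < i \<and> (\<forall>k<N. j \<le> k \<and> k \<le> i)"
    then have "j \<le> 0" "N - 1 \<le> i" using assms by auto
    then show "j = 0 \<and> i = N - 1" using assms by simp
  qed (use assms in auto)
  finally show ?thesis .
qed

end

lemma enumeration_exists:
  assumes "finite (V :: nat set)"
  obtains e where "strict_mono_on {..<card V} e" "V = e ` {..<card V}"
proof -
  let ?l = "sorted_list_of_set V"
  have "strict_mono_on {..<card V} (\<lambda>i. ?l ! i)"
    by (rule strict_mono_onI)
      (use sorted_wrt_nth_less[OF strict_sorted_list_of_set] in \<open>simp add: length_sorted_list_of_set\<close>)
  moreover have "set ?l = (\<lambda>i. ?l ! i) ` {..<length ?l}" by (auto simp: set_conv_nth)
  then have "V = (\<lambda>i. ?l ! i) ` {..<card V}" using assms by simp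
  ultimately show ?thesis by (rule that)
qed

text \<open>The base case: by \<open>chord_gt_1\<close> every diagonal exceeds \<open>1\<close>, so
  the polygon is its own only subpolygon, and each vertex has count \<open>1\<close> and quiddity
  \<open>chord p 2\<close>.\<close>

lemma angulated_regular:
  assumes p: "3 \<le> p" and e: "strict_mono_on {..<p} e" "V = e ` {..<p}"
    and w: "\<And>i k. i + k < p \<Longrightarrow> wedge (v (e i)) (v (e (i + k))) = chord p k"
  shows "angulated p V v" and "unit_diagonals V v = {}"
proof -
  note less = enum_less[OF e]
  have fin: "finite V" and card: "card V = p" using e card_enum[OF e] by auto
  have w': "wedge (v (e i)) (v (e j)) = chord p (j - i)" if "i \<le> j" "j < p" for i j
    using w[of i "j - i"] that by simp
  have ge: "1 \<le> wedge (v (e i)) (v (e j))" if "i < j" "j < p" for i j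
    using chord_ge_1[OF p, of "j - i"] w'[of i j] that by simp
  have gt: "1 < wedge (v (e i)) (v (e j))" if "i < p" "j < p" "sep_pair V (e i) (e j)" for i j
  proof -
    have "i + 2 \<le> j" "0 < i \<or> j + 1 < p" using sep_pair_enum[OF e, of i j] that by auto
    then show ?thesis using chord_gt_1[OF p, of "j - i"] w'[of i j] that by auto
  qed
  show u: "unit_diagonals V v = {}"
  proof -
    have "wedge (v x) (v y) \<noteq> 1" if xy: "sep_pair V x y" for x y
    proof -
      obtain i j where "x = e i" "y = e j" "i < p" "j < p"
        using xy e(2) unfolding sep_pair_def by auto
      then show ?thesis using gt[of i j] xy by simp
    qed
    then show ?thesis unfolding unit_diagonals_def by blast
  qed
  have "1 \<le> wedge (v x) (v y) \<and> (\<not> sep_pair V x y \<longrightarrow> wedge (v x) (v y) = 1)"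
    if xy: "x \<in> V" "y \<in> V" "x < y" for x y
  proof -
    obtain i j where ij: "x = e i" "y = e j" "i < p" "j < p" using xy e(2) by auto
    then have "i < j" using less xy(3) by simp
    then have "1 \<le> wedge (v x) (v y)" using ge ij by simp
    moreover have "wedge (v x) (v y) = 1" if "\<not> sep_pair V x y"
    proof -
      have "j - i = 1 \<or> j - i = p - 1" using that sep_pair_enum[OF e ij(3,4)] ij \<open>i < j\<close> by auto
      then show ?thesis using w'[of i j] ij \<open>i < j\<close> chord_1[OF p] chord_end[OF p] by auto
    qed
    ultimately show ?thesis by blast
  qed
  moreover from this have "realization V v" unfolding realization_def by fastforce
  moreover have "p_angulation p V nat_cyc {}"
    using subpolygons_empty[OF fin] card p unfolding p_angulation_def polygon_dissection_def by simp
  moreover have "\<bar>wedge (v x) (v z)\<bar> = frieze_lambda p * real (card {S \<in> subpolygons V nat_cyc {}. y \<in> S})"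
    if xy: "next_vertex V nat_cyc x y" and yz: "next_vertex V nat_cyc y z" for x y z
  proof -
    have "{S \<in> subpolygons V nat_cyc {}. y \<in> S} = {V}"
      using subpolygons_empty[OF fin] card p xy unfolding next_vertex_def by auto
    moreover have "\<bar>wedge (v x) (v z)\<bar> = frieze_lambda p"
    proof -
      obtain i j k where ijk: "x = e i" "y = e j" "z = e k" "i < p" "j < p" "k < p"
        using xy yz e(2) unfolding next_vertex_def by auto
      have "j = Suc i \<or> j = 0 \<and> i = p - 1" "k = Suc j \<or> k = 0 \<and> j = p - 1"
        using next_vertex_enum[OF e, of i j] next_vertex_enum[OF e, of j k] xy yz ijk p by auto
      \<comment> \<open>The neighbours of a vertex are \<open>2\<close> steps apart, or
        \<open>p - 2\<close> when the path wraps around; \<open>chord_symmetric\<close> makes both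
        chords equal.\<close>
      then have "k = i + 2 \<or> i = k + (p - 2)" using p by auto
      moreover have "chord p (p - 2) = frieze_lambda p"
        using chord_symmetric[OF p, of 2] chord_2[OF p] p by simp
      ultimately show ?thesis
        using w[of i 2] w[of k "p - 2"] chord_2[OF p] frieze_lambda_ge_1[OF p] ijk
          wedge_swap[of "v x" "v z"] by auto
    qed
    ultimately show ?thesis by simp
  qed
  ultimately show "angulated p V v" unfolding angulated_def u by blast
qed


lemma card_inner_outer:
  assumes "sep_pair V a b" "finite V"
  shows "card (inner V a b) < card V" "card (outer V a b) < card V"
    "3 \<le> card (inner V a b)" "3 \<le> card (outer V a b)"
proof -
  obtain c d where c: "c \<in> V" "a < c" "c < b" and d: "d \<in> V" "d < a \<or> b < d" and ab: "a \<in> V" "b \<in> V" "a < b"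
    using assms(1) unfolding sep_pair_def by auto
  have fin: "finite (inner V a b)" "finite (outer V a b)" using assms(2) by auto
  have "d \<notin> inner V a b" "c \<notin> outer V a b" using c d by auto
  then have "inner V a b \<subset> V" "outer V a b \<subset> V" using c(1) d(1) by blast+
  then show "card (inner V a b) < card V" "card (outer V a b) < card V"
    using assms(2) by (auto intro: psubset_card_mono)
  have "{a, b, c} \<subseteq> inner V a b" "{a, b, d} \<subseteq> outer V a b" using ab c d by auto
  then have "card {a, b, c} \<le> card (inner V a b)" "card {a, b, d} \<le> card (outer V a b)"
    using fin by (auto intro: card_mono)
  moreover have "card {a, b, c} = 3" "card {a, b, d} = 3" using ab c d by auto
  ultimately show "3 \<le> card (inner V a b)" "3 \<le> card (outer V a b)" by linarith+
qed

section \<open>Cutting off regular ears\<close>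

definition typed_realization :: "nat \<Rightarrow> nat set \<Rightarrow> (nat \<Rightarrow> real \<times> real) \<Rightarrow> bool" where
  "typed_realization p V v \<longleftrightarrow> realization V v \<and>
     (\<forall>x y z. next_vertex V nat_cyc x y \<longrightarrow> next_vertex V nat_cyc y z \<longrightarrow>
        (\<exists>m::int. \<bar>wedge (v x) (v z)\<bar> = of_int m * frieze_lambda p))"

lemma typed_realizationD:
  assumes "typed_realization p V v" "next_vertex V nat_cyc x y" "next_vertex V nat_cyc y z"
  obtains m :: int where "\<bar>wedge (v x) (v z)\<bar> = of_int m * frieze_lambda p"
  using assms unfolding typed_realization_def by blast

lemma typed_realization_of_angulated:
  assumes "angulated p V v"
  shows "typed_realization p V v"
  unfolding typed_realization_def
proof (intro conjI allI impI)
  show "realization V v" using assms unfolding angulated_def by blast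
  fix x y z assume "next_vertex V nat_cyc x y" "next_vertex V nat_cyc y z"
  then have "\<bar>wedge (v x) (v z)\<bar> =
      frieze_lambda p * real (card {S \<in> subpolygons V nat_cyc (unit_diagonals V v). y \<in> S})"
    using assms unfolding angulated_def by blast
  then show "\<exists>m::int. \<bar>wedge (v x) (v z)\<bar> = of_int m * frieze_lambda p"
    by (metis mult.commute of_int_of_nat_eq)
qed

text \<open>Only at \<open>a\<close> and \<open>b\<close> do the neighbours change. There
  \<open>quiddity_cut\<close> makes the outer quiddity the difference of those of \<open>V\<close>
  and of the inner polygon, again an integral multiple of \<open>frieze_lambda p\<close>.\<close>

lemma typed_realization_outer:
  assumes V: "finite V" and ab: "sep_pair V a b" and w: "wedge (v a) (v b) = 1"
    and T: "typed_realization p V v" and I: "typed_realization p (inner V a b) v"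
  shows "typed_realization p (outer V a b) v"
  unfolding typed_realization_def
proof (intro conjI allI impI)
  have r: "realization V v" using T unfolding typed_realization_def by blast
  have ab': "a \<in> V" "b \<in> V" "a < b" using ab unfolding sep_pair_def by auto
  show "realization (outer V a b) v" by (rule realization_cut(2)[OF r ab w])
  fix x y z assume xy: "next_vertex (outer V a b) nat_cyc x y" and yz: "next_vertex (outer V a b) nat_cyc y z"
  note cut = next_vertex_cut[OF ab']
  have y: "y \<in> V" "y \<le> a \<or> b \<le> y" using xy unfolding next_vertex_def by auto
  have "\<exists>c\<in>V. c \<noteq> y" using ab' by (cases "y = a") auto
  then obtain x' z' where x': "next_vertex V nat_cyc x' y" and z': "next_vertex V nat_cyc y z'"
    using next_vertex_exists[OF V y(1)] by metis
  obtain m :: int where m: "\<bar>wedge (v x') (v z')\<bar> = of_int m * frieze_lambda p"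
    by (rule typed_realizationD[OF T x' z'])
  consider "y < a \<or> b < y" | "y = a" | "y = b" using y(2) by linarith
  then show "\<exists>m::int. \<bar>wedge (v x) (v z)\<bar> = of_int m * frieze_lambda p"
  proof cases
    case 1
    then have "next_vertex (outer V a b) nat_cyc x' y" "next_vertex (outer V a b) nat_cyc y z'"
      using next_vertex_outer(1)[OF ab x'] next_vertex_outer(2)[OF ab z'] by auto
    then have "x' = x" "z' = z" using next_vertex_unique xy yz by blast+
    then show ?thesis using m by blast
  next
    case 2
    then have "next_vertex (outer V a b) nat_cyc x' y" using next_vertex_outer(1)[OF ab x'] by auto
    then have "x' = x" using next_vertex_unique(2)[OF xy] by blast
    moreover have "z = b" using next_vertex_unique(1)[OF cut(2)] yz 2 by blast
    moreover have "next_vertex (inner V a b) nat_cyc a z'" "next_vertex (inner V a b) nat_cyc b a"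
      using next_vertex_inner(2)[OF ab z'] 2 ab' cut by auto
    then obtain k :: int where "\<bar>wedge (v b) (v z')\<bar> = of_int k * frieze_lambda p"
      using typed_realizationD[OF I] by metis
    ultimately have "\<bar>wedge (v x) (v z)\<bar> = of_int (m - k) * frieze_lambda p"
      using quiddity_cut(1)[OF r ab w x' z' 2] m by (simp add: algebra_simps)
    then show ?thesis by blast
  next
    case 3
    then have "next_vertex (outer V a b) nat_cyc y z'" using next_vertex_outer(2)[OF ab z'] by auto
    then have "z' = z" using next_vertex_unique(1)[OF yz] by blast
    moreover have "x = a" using next_vertex_unique(2)[OF cut(2)] xy 3 by blast
    moreover have "next_vertex (inner V a b) nat_cyc x' b" "next_vertex (inner V a b) nat_cyc b a"
      using next_vertex_inner(1)[OF ab x'] 3 ab' cut by auto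
    then obtain k :: int where "\<bar>wedge (v x') (v a)\<bar> = of_int k * frieze_lambda p"
      using typed_realizationD[OF I] by metis
    ultimately have "\<bar>wedge (v x) (v z)\<bar> = of_int (m - k) * frieze_lambda p"
      using quiddity_cut(2)[OF r ab w x' z' 3] m by (simp add: algebra_simps)
    then show ?thesis by blast
  qed
qed

text \<open>Induction on the number of vertices. A run from \<open>lambda_run_exists\<close> spans a
  regular ear by \<open>lambda_run_wedge\<close>; the rest keeps its type by
  \<open>typed_realization_outer\<close>, and \<open>angulated_glue\<close> puts the ear
  back.\<close>

lemma angulated_of_typed_realization:
  assumes p: "3 \<le> p" and "finite V" "3 \<le> card V" "typed_realization p V v"
  shows "angulated p V v"
  using assms(2-)
proof (induction "card V" arbitrary: V rule: less_induct)
  case less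
  define N where "N = card V"
  have N: "3 \<le> N" using less.prems N_def by simp
  obtain e where e: "strict_mono_on {..<N} e" "V = e ` {..<N}"
    using enumeration_exists[OF less.prems(1)] N_def by metis
  note enum = enum_less[OF e]
  define w where "w = v \<circ> e"
  have r: "realization V v" using less.prems(3) unfolding typed_realization_def by blast
  have eV: "e i \<in> V" if "i < N" for i using e(2) that by auto
  have pos: "0 < wedge (w i) (w j)" if "i < j" "j < N" for i j
    using realization_pos[OF r eV eV, of i j] enum[of i j] that unfolding w_def by simp
  have edge: "wedge (w i) (w j) = 1" if "i < j" "j < N" "\<not> (i + 2 \<le> j \<and> (0 < i \<or> j + 1 < N))" for i j
    using realization_edge[OF r eV eV, of i j] enum[of i j] sep_pair_enum[OF e, of i j] that unfolding w_def by simp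
  \<comment> \<open>A positive integral multiple of \<open>frieze_lambda p\<close> is either this
    number or at least twice it. The second alternative of \<open>nn\<close> covers the vertices at
    which the order wraps around.\<close>
  have quid: "wedge (w i) (w j) = frieze_lambda p \<or> 2 * frieze_lambda p \<le> wedge (w i) (w j)"
    if ij: "i < j" "j < N" and nn: "next_vertex V nat_cyc (e i) y \<and> next_vertex V nat_cyc y (e j) \<or>
      next_vertex V nat_cyc (e j) y \<and> next_vertex V nat_cyc y (e i)" for i j y
  proof -
    obtain m :: int where m: "wedge (w i) (w j) = of_int m * frieze_lambda p"
      using nn typed_realizationD[OF less.prems(3)] pos[OF ij] wedge_swap[of "w j" "w i"]
      unfolding w_def by (smt (verit) comp_apply)
    then have "0 < m" using pos[OF ij] frieze_lambda_ge_1[OF p] by (simp add: zero_less_mult_iff)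
    then have "m = 1 \<or> 2 \<le> m" by linarith
    then show ?thesis
    proof
      assume "2 \<le> m"
      then have "2 * frieze_lambda p \<le> of_int m * frieze_lambda p"
        using frieze_lambda_ge_1[OF p] by (intro mult_right_mono) auto
      then show ?thesis using m by simp
    qed (use m in simp)
  qed
  have nxt: "next_vertex V nat_cyc (e i) (e (Suc i))" if "Suc i < N" for i
    using next_vertex_enum[OF e, of i "Suc i"] that by simp
  have nxt0: "next_vertex V nat_cyc (e (N - 1)) (e 0)"
    using next_vertex_enum[OF e, of "N - 1" 0] N by simp
  obtain t where t: "t + p \<le> N" and run: "\<And>k. t \<le> k \<Longrightarrow> k + 2 < t + p \<Longrightarrow> wedge (w k) (w (k + 2)) = frieze_lambda p"
  proof -
    have "\<exists>t. t + p \<le> N \<and> (\<forall>k. t \<le> k \<and> k + 2 < t + p \<longrightarrow> wedge (w k) (w (k + 2)) = frieze_lambda p)"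
    proof (rule lambda_run_exists[OF p N _ pos])
      show "wedge (w i) (w (Suc i)) = 1" if "Suc i < N" for i using edge[of i "Suc i"] that by simp
      show "wedge (w 0) (w (N - 1)) = 1" using edge[of 0 "N - 1"] N by simp
      show "wedge (w i) (w (i + 2)) = frieze_lambda p \<or> 2 * frieze_lambda p \<le> wedge (w i) (w (i + 2))"
        if "i + 2 < N" for i
        using quid[of i "i + 2" "e (Suc i)"] nxt[of i] nxt[of "Suc i"] that by simp
      \<comment> \<open>\<open>wedge (w 0) (w (N - 2))\<close> is the quiddity at the last vertex,
        whose successor is the first one.\<close>
      have "Suc (N - 2) = N - 1" using N by simp
      then show "frieze_lambda p \<le> wedge (w 0) (w (N - 2))"
        using quid[of 0 "N - 2" "e (N - 1)"] nxt[of "N - 2"] nxt0 N frieze_lambda_ge_1[OF p] by auto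
    qed
    then show ?thesis using that by blast
  qed
  \<comment> \<open>The run sits at the \<open>p - 2\<close> vertices from \<open>t + 1\<close> to
    \<open>t + p - 2\<close>; with their outer neighbours they form a block of \<open>p\<close>
    vertices with ends \<open>a\<close> and \<open>b\<close>.\<close>
  define a b where "a = e t" and "b = e (t + p - 1)"
  have tN: "t < N" "t + p - 1 < N" using t p by auto
  have inner: "inner V a b = (\<lambda>i. e (t + i)) ` {..<p}"
  proof (intro equalityI subsetI)
    fix x assume "x \<in> inner V a b"
    then obtain i where i: "i < N" "x = e i" "e t \<le> e i" "e i \<le> e (t + p - 1)"
      using e(2) unfolding a_def b_def by auto
    then have "t \<le> i" "i \<le> t + p - 1" using enum_le[OF e] tN by auto
    then show "x \<in> (\<lambda>i. e (t + i)) ` {..<p}" using i p by (intro image_eqI[of _ _ "i - t"]) auto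
  next
    fix x assume "x \<in> (\<lambda>i. e (t + i)) ` {..<p}"
    then obtain i where i: "i < p" "x = e (t + i)" by auto
    then show "x \<in> inner V a b"
      using enum_le[OF e, of t "t + i"] enum_le[OF e, of "t + i" "t + p - 1"] eV[of "t + i"] t tN
      unfolding a_def b_def by auto
  qed
  have I: "angulated p (inner V a b) v"
  proof (rule angulated_regular(1)[OF p _ inner])
    show "strict_mono_on {..<p} (\<lambda>i. e (t + i))"
      by (rule strict_mono_onI) (use enum t in auto)
    have "wedge (w (t + i)) (w (t + (i + k))) = chord p k" if "i + k < p" for i k
    proof (rule lambda_run_wedge[OF p, of "\<lambda>i. w (t + i)"])
      show "wedge (w (t + i)) (w (t + Suc i)) = 1" if "Suc i < p" for i
        using edge[of "t + i" "t + Suc i"] that t by simp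
      show "wedge (w (t + i)) (w (t + (i + 2))) = frieze_lambda p" if "i + 2 < p" for i
        using run[of "t + i"] that by simp
    qed (rule that)
    then show "wedge (v (e (t + i))) (v (e (t + (i + k)))) = chord p k" if "i + k < p" for i k
      using that unfolding w_def by simp
  qed
  show ?case
  proof (cases "sep_pair V a b")
    case True
    have "a \<in> inner V a b" "b \<in> inner V a b" "a < b" using True unfolding sep_pair_def by auto
    then have wab: "wedge (v a) (v b) = 1"
      using I realization_edge[of "inner V a b" v a b] unfolding angulated_def by (auto simp: sep_pair_def)
    have "angulated p (outer V a b) v"
      using less.hyps[of "outer V a b"] card_inner_outer[OF True less.prems(1)] less.prems(1)
        typed_realization_outer[OF less.prems(1) True wab less.prems(3) typed_realization_of_angulated[OF I]]
      by blast
    then show ?thesis using angulated_glue(1)[OF True I _ less.prems(1)] by blast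
  next
    case False
    \<comment> \<open>Since \<open>3 \<le> p\<close>, the chord \<open>{a, b}\<close> is an edge
      only if the block is all of \<open>V\<close>.\<close>
    then have "t = 0" "p = N"
      using sep_pair_enum[OF e, of t "t + p - 1"] tN p t unfolding a_def b_def by auto
    then have "inner V a b = V" using inner e(2) by simp
    then show ?thesis using I by simp
  qed
qed

text \<open>All notions involved are expressed by wedges, so a realization may be moved by a linear
  map of determinant \<open>1\<close> before gluing.\<close>

lemma angulated_cong:
  assumes "\<And>x y. x \<in> V \<Longrightarrow> y \<in> V \<Longrightarrow> wedge (v x) (v y) = wedge (v' x) (v' y)"
  shows "unit_diagonals V v = unit_diagonals V v'" "angulated p V v \<Longrightarrow> angulated p V v'"
proof -
  show u: "unit_diagonals V v = unit_diagonals V v'"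
  proof -
    have "sep_pair V x y \<and> wedge (v x) (v y) = 1 \<longleftrightarrow> sep_pair V x y \<and> wedge (v' x) (v' y) = 1" for x y
      using assms[of x y] unfolding sep_pair_def by auto
    then show ?thesis unfolding unit_diagonals_def by simp
  qed
  assume A: "angulated p V v"
  have "realization V v'"
    using A assms unfolding angulated_def realization_def by simp
  moreover have "\<bar>wedge (v' x) (v' z)\<bar> =
        frieze_lambda p * real (card {S \<in> subpolygons V nat_cyc (unit_diagonals V v'). y \<in> S})"
    if "next_vertex V nat_cyc x y" "next_vertex V nat_cyc y z" for x y z
  proof -
    have "x \<in> V" "z \<in> V" using that unfolding next_vertex_def by auto
    moreover have "\<bar>wedge (v x) (v z)\<bar> =
        frieze_lambda p * real (card {S \<in> subpolygons V nat_cyc (unit_diagonals V v). y \<in> S})"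
      using A that unfolding angulated_def by blast
    ultimately show ?thesis using assms u by simp
  qed
  ultimately show "angulated p V v'"
    using A assms u unfolding angulated_def by simp
qed

text \<open>Induction on the number of vertices. Without diagonals the polygon is a
  \<open>p\<close>-gon; otherwise the two sides of any diagonal are realized separately, and one of
  them is moved so that they agree at its ends.\<close>

lemma angulated_exists:
  assumes p: "3 \<le> p" and "finite V" "3 \<le> card V" "p_angulation p V nat_cyc D"
  shows "\<exists>v. angulated p V v \<and> unit_diagonals V v = D"
  using assms(2-)
proof (induction "card V" arbitrary: V D rule: less_induct)
  case less
  show ?case
  proof (cases "D = {}")
    case True
    then have "card V = p"
      using less.prems subpolygons_empty[of V] unfolding p_angulation_def by auto
    then obtain e where e: "strict_mono_on {..<p} e" "V = e ` {..<p}"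
      using enumeration_exists[OF less.prems(1)] by metis
    \<comment> \<open>Points at the angles \<open>0, pi / p, ..., (p - 1) * pi / p\<close> on a
      circle whose radius makes neighbouring wedges \<open>1\<close>. The angles stay within half a
      turn, so wedges in increasing order are positive.\<close>
    define v where "v x = (let k = real (the_inv_into {..<p} e x) * (pi / real p); s = sqrt (sin (pi / real p))
      in (cos k / s, sin k / s))" for x
    have "wedge (v (e i)) (v (e (i + k))) = chord p k" if "i + k < p" for i k
    proof -
      let ?t = "pi / real p"
      have "the_inv_into {..<p} e (e j) = j" if "j < p" for j
        using that strict_mono_on_imp_inj_on[OF e(1)] by (simp add: the_inv_into_f_f)
      then have "wedge (v (e i)) (v (e (i + k))) =
        (cos (real i * ?t) * sin (real (i + k) * ?t) - sin (real i * ?t) * cos (real (i + k) * ?t)) / sin ?t"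
        using that sin_pi_div_pos[OF p] unfolding v_def wedge_def Let_def
        by (simp add: diff_divide_distrib)
      also have "cos (real i * ?t) * sin (real (i + k) * ?t) - sin (real i * ?t) * cos (real (i + k) * ?t) =
          sin (real (i + k) * ?t - real i * ?t)"
        by (simp only: sin_diff) (simp add: algebra_simps)
      also have "real (i + k) * ?t - real i * ?t = real k * ?t" by (simp add: distrib_right add_divide_distrib)
      finally show ?thesis by (simp add: chord_def)
    qed
    then show ?thesis using angulated_regular[OF p e, of v] True by blast
  next
    case False
    then obtain d where "d \<in> D" by blast
    moreover have dis: "polygon_dissection V nat_cyc D" using less.prems unfolding p_angulation_def by blast
    ultimately obtain a b where ab: "{a, b} \<in> D" "a < b" "sep_pair V a b"
      using mem_polygon_dissection by metis
    let ?I = "inner V a b" and ?O = "outer V a b"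
    have ab': "a \<in> V" "b \<in> V" using ab(3) unfolding sep_pair_def by auto
    note cut = p_angulation_cut[OF less.prems(3) ab(1,2) less.prems(1)]
    note cards = card_inner_outer[OF ab(3) less.prems(1)]
    obtain f where f: "angulated p ?I f" "unit_diagonals ?I f = D \<inter> diagonals ?I nat_cyc"
      using less.hyps[OF cards(1) _ cards(3) cut(1)] less.prems(1) by auto
    obtain g where g: "angulated p ?O g" "unit_diagonals ?O g = D \<inter> diagonals ?O nat_cyc"
      using less.hyps[OF cards(2) _ cards(4) cut(2)] less.prems(1) by auto
    have wf: "wedge (f a) (f b) = 1"
      using f(1) ab' ab(2) unfolding angulated_def by (auto intro!: realization_edge simp: sep_pair_def)
    have wg: "wedge (g a) (g b) = 1"
      using g(1) ab' ab(2) unfolding angulated_def by (auto intro!: realization_edge simp: sep_pair_def)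
    text \<open>The unimodular linear map that takes \<open>g a\<close> to \<open>f a\<close> and \<open>g b\<close> to \<open>f b\<close>.\<close>
    define T where "T u = (wedge u (g b) * fst (f a) + wedge (g a) u * fst (f b),
      wedge u (g b) * snd (f a) + wedge (g a) u * snd (f b))" for u
    have T: "wedge (T u) (T t) = wedge u t" for u t
    proof -
      have "wedge (T u) (T t) = (wedge u (g b) * wedge (g a) t - wedge (g a) u * wedge t (g b)) * wedge (f a) (f b)"
        unfolding T_def by (simp add: wedge_def algebra_simps)
      also have "wedge u (g b) * wedge (g a) t - wedge (g a) u * wedge t (g b) = wedge u t * wedge (g a) (g b)"
        unfolding wedge_def by algebra
      finally show ?thesis using wf wg by simp
    qed
    define v where "v x = (if x \<in> ?I then f x else T (g x))" for x
    \<comment> \<open>\<open>?I\<close> and \<open>?O\<close> overlap in \<open>a\<close> and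
      \<open>b\<close>, where the two branches of \<open>v\<close> agree.\<close>
    have "T (g a) = f a" "T (g b) = f b"
      using wg unfolding T_def by simp_all
    then have vO: "v x = T (g x)" if "x \<in> ?O" for x
      using that ab(2) unfolding v_def by (cases "x = a"; cases "x = b") auto
    have fv: "wedge (f x) (f y) = wedge (v x) (v y)" if "x \<in> ?I" "y \<in> ?I" for x y
      using that unfolding v_def by simp
    have gv: "wedge (g x) (g y) = wedge (v x) (v y)" if "x \<in> ?O" "y \<in> ?O" for x y
      using that vO T by simp
    have "angulated p ?I v" "unit_diagonals ?I v = D \<inter> diagonals ?I nat_cyc"
      using angulated_cong[of ?I f v] fv f by auto
    moreover have "angulated p ?O v" "unit_diagonals ?O v = D \<inter> diagonals ?O nat_cyc"
      using angulated_cong[of ?O g v] gv g by auto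
    ultimately have "angulated p V v" "unit_diagonals V v = D"
      using angulated_glue[OF ab(3) _ _ less.prems(1)] dissection_cut[OF dis ab(1,2)] by auto
    then show ?thesis by blast
  qed
qed

section \<open>Frieze patterns as realizations\<close>

lemma frieze_patternD:
  assumes "frieze_pattern n F"
  shows "F 0 k = 0" "F (n + 3) k = 0" "F (Suc 0) k = 1" "F (n + 2) k = 1"
    "r \<le> n + 1 \<Longrightarrow> 0 < F (r + 1) k"
    "r \<le> n + 1 \<Longrightarrow> F (r + 1) k * F (r + 1) (k + 1) - F (r + 2) k * F r (k + 1) = 1"
    "n + 3 < r \<Longrightarrow> F r k = 0"
proof -
  \<comment> \<open>The rows \<open>1\<close> and \<open>n + 2\<close> consist of ones, which gives
    positivity at both ends of the range.\<close>
  have "r = 0 \<or> r = n + 1 \<or> r + 1 \<in> {2..n + 1}" if "r \<le> n + 1" using that by auto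
  then show "r \<le> n + 1 \<Longrightarrow> 0 < F (r + 1) k"
    using assms unfolding frieze_pattern_def by fastforce
qed (use assms in \<open>auto simp: frieze_pattern_def\<close>)

context
  fixes n :: nat and F :: "nat \<Rightarrow> int \<Rightarrow> real"
  assumes F: "frieze_pattern n F"
begin

lemmas frieze_facts = frieze_patternD[OF F]

text \<open>The diamond rules at two successive heights and the induction hypothesis combine to the
  claim multiplied by \<open>F (r + 1) (k + 1)\<close>, which is positive and cancels.\<close>

lemma frieze_right_rec: "r \<le> n + 1 \<Longrightarrow> F (r + 2) k = F 2 (k + int r) * F (r + 1) k - F r k"
proof (induction r arbitrary: k)
  case 0
  then show ?case using frieze_facts(1,3) by (simp add: numeral_2_eq_2)
next
  case (Suc r)
  let ?c = "F 2 (k + int (Suc r))"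
  have IH: "F (r + 2) (k + 1) = ?c * F (r + 1) (k + 1) - F r (k + 1)"
    using Suc.IH[of "k + 1"] Suc.prems by (simp add: add.assoc)
  have d1: "F (r + 2) k * F (r + 2) (k + 1) - F (r + 3) k * F (r + 1) (k + 1) = 1"
    using frieze_facts(6)[of "Suc r" k] Suc.prems by (simp add: numeral_eq_Suc)
  have d2: "F (r + 1) k * F (r + 1) (k + 1) - F (r + 2) k * F r (k + 1) = 1"
    using frieze_facts(6)[of r k] Suc.prems by simp
  have "F (r + 3) k * F (r + 1) (k + 1) = (?c * F (r + 2) k - F (r + 1) k) * F (r + 1) (k + 1)"
    using d1 d2 unfolding IH by (simp add: algebra_simps)
  moreover have "0 < F (r + 1) (k + 1)" using frieze_facts(5) Suc.prems by simp
  ultimately have "F (r + 3) k = ?c * F (r + 2) k - F (r + 1) k" by simp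
  then show ?case by (simp add: numeral_eq_Suc)
qed

text \<open>The mirror image of \<open>frieze_right_rec\<close>, with the quiddity at the left end
  of the entry; comparing the two yields the periodicity.\<close>

lemma frieze_left_rec: "r \<le> n + 1 \<Longrightarrow> F (r + 2) k = F 2 k * F (r + 1) (k + 1) - F r (k + 2)"
proof (induction r arbitrary: k)
  case 0
  then show ?case using frieze_facts(1,3) by (simp add: numeral_2_eq_2)
next
  case (Suc r)
  let ?c = "F 2 k"
  have IH: "F (r + 2) k = ?c * F (r + 1) (k + 1) - F r (k + 2)"
    using Suc.IH[of k] Suc.prems by simp
  have d1: "F (r + 2) k * F (r + 2) (k + 1) - F (r + 3) k * F (r + 1) (k + 1) = 1"
    using frieze_facts(6)[of "Suc r" k] Suc.prems by (simp add: numeral_eq_Suc)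
  have d2: "F (r + 1) (k + 1) * F (r + 1) (k + 2) - F (r + 2) (k + 1) * F r (k + 2) = 1"
    using frieze_facts(6)[of r "k + 1"] Suc.prems by (simp add: add.assoc)
  have "F (r + 3) k * F (r + 1) (k + 1) = (?c * F (r + 2) (k + 1) - F (r + 1) (k + 2)) * F (r + 1) (k + 1)"
    using d1 d2 unfolding IH by (simp add: algebra_simps)
  moreover have "0 < F (r + 1) (k + 1)" using frieze_facts(5) Suc.prems by simp
  ultimately have "F (r + 3) k = ?c * F (r + 2) (k + 1) - F (r + 1) (k + 2)" by simp
  then show ?case by (simp add: numeral_eq_Suc)
qed

lemma frieze_row_below_ones: "F (n + 1) k = F 2 (k + int (n + 1))"
proof -
  have "F (n + 3) k = F 2 (k + int (n + 1)) * F (n + 2) k - F (n + 1) k"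
    using frieze_right_rec[of "n + 1" k] by (simp add: numeral_eq_Suc)
  then show ?thesis using frieze_facts(2)[of k] frieze_facts(4)[of k] by simp
qed

text \<open>In the zero row \<open>n + 3\<close> the two recurrences express row
  \<open>n + 1\<close> by the quiddity row in two ways, whose indices differ by
  \<open>n + 3\<close>.\<close>

lemma quiddity_periodic: "F 2 (k + int (n + 3)) = F 2 k"
proof -
  have "F (n + 3) k = F 2 k * F (n + 2) (k + 1) - F (n + 1) (k + 2)"
    using frieze_left_rec[of "n + 1" k] by (simp add: numeral_eq_Suc)
  then have "F (n + 1) (k + 2) = F 2 k" using frieze_facts(2)[of k] frieze_facts(4)[of "k + 1"] by simp
  then show ?thesis using frieze_row_below_ones[of "k + 2"] by (simp add: algebra_simps)
qed

lemma quiddity_mod: "F 2 (k mod int (n + 3)) = F 2 k"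
proof -
  have *: "F 2 (l + int m * int (n + 3)) = F 2 l" for l m
  proof (induction m)
    case (Suc m)
    have "l + int (Suc m) * int (n + 3) = l + int m * int (n + 3) + int (n + 3)"
      by (simp add: algebra_simps)
    then show ?case by (simp only: Suc quiddity_periodic)
  qed simp
  have k: "k = k mod int (n + 3) + k div int (n + 3) * int (n + 3)"
    by (simp only: mod_div_mult_eq)
  show ?thesis
  proof (cases "0 \<le> k div int (n + 3)")
    case True
    then show ?thesis using *[of "k mod int (n + 3)" "nat (k div int (n + 3))"] k by simp
  next
    case False
    then have "k mod int (n + 3) = k + int (nat (- (k div int (n + 3)))) * int (n + 3)"
      using k by (simp add: algebra_simps)
    then show ?thesis using *[of k "nat (- (k div int (n + 3)))"] by simp
  qed
qed

end

lemma frieze_pattern_eqI: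
  assumes "frieze_pattern n F" "frieze_pattern n G" "\<And>k. F 2 k = G 2 k"
  shows "F = G"
proof -
  have "F r k = G r k" for r k
  proof (induction r rule: less_induct)
    case (less r)
    consider "n + 3 < r" | "r = 0" | "r = 1" | s where "r = s + 2" "s \<le> n + 1"
      by (metis One_nat_def add_2_eq_Suc' add_le_imp_le_right not0_implies_Suc not_less numeral_3_eq_3
          add_Suc_right Suc_le_mono plus_1_eq_Suc add.commute)
    then show ?case
    proof cases
      case 4
      then show ?thesis
        using frieze_right_rec[OF assms(1), of s k] frieze_right_rec[OF assms(2), of s k] assms(3)
          less.IH[of s] less.IH[of "s + 1"] by simp
    qed (use frieze_patternD[OF assms(1)] frieze_patternD[OF assms(2)] in auto)
  qed
  then show ?thesis by blast
qed

section \<open>The vectors of a frieze pattern\<close>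

text \<open>The recurrence \<open>frieze_right_rec\<close> started from the standard basis.
  \<open>F 2 (int i)\<close> becomes the wedge of the vectors \<open>i\<close> and
  \<open>i + 2\<close>, so it belongs to vertex \<open>i + 1\<close>; hence the shift by one in
  quiddity indices below.\<close>

fun frieze_vector :: "(nat \<Rightarrow> int \<Rightarrow> real) \<Rightarrow> nat \<Rightarrow> real \<times> real" where
  "frieze_vector F 0 = (1, 0)"
| "frieze_vector F (Suc 0) = (0, 1)"
| "frieze_vector F (Suc (Suc i)) =
    (F 2 (int i) * fst (frieze_vector F (Suc i)) - fst (frieze_vector F i),
     F 2 (int i) * snd (frieze_vector F (Suc i)) - snd (frieze_vector F i))"

lemma wedge_frieze_vector_rec:
  "wedge u (frieze_vector F (Suc (Suc i))) =
    F 2 (int i) * wedge u (frieze_vector F (Suc i)) - wedge u (frieze_vector F i)"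
  by (simp add: wedge_def algebra_simps)

lemma wedge_frieze_vector_Suc: "wedge (frieze_vector F i) (frieze_vector F (Suc i)) = 1"
proof (induction i)
  case (Suc i)
  then show ?case
    using wedge_swap[of "frieze_vector F (Suc i)" "frieze_vector F i"] by (simp only: wedge_frieze_vector_rec wedge_self)
qed (simp add: wedge_def)

lemma wedge_frieze_vector:
  assumes "frieze_pattern n F" "r \<le> n + 3"
  shows "wedge (frieze_vector F i) (frieze_vector F (i + r)) = F r (int i)"
  using assms(2)
proof (induction r rule: less_induct)
  case (less r)
  consider "r = 0" | "r = 1" | s where "r = s + 2"
    by (metis One_nat_def add_2_eq_Suc' not0_implies_Suc)
  then show ?case
  proof cases
    case 3
    then show ?thesis
      using less.IH[of s] less.IH[of "s + 1"] less.prems frieze_right_rec[OF assms(1), of s "int i"]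
        wedge_frieze_vector_rec[of "frieze_vector F i" F "i + s"] by simp
  qed (use frieze_patternD[OF assms(1)] wedge_frieze_vector_Suc in auto)
qed

lemma strict_mono_on_id: "strict_mono_on {..<N} (\<lambda>i::nat. i)"
  by (rule strict_mono_onI) simp

lemma next_vertex_lessThan:
  assumes "2 \<le> N"
  shows "next_vertex {..<N} nat_cyc i j \<longleftrightarrow> i < N \<and> j < N \<and> (j = Suc i \<or> j = 0 \<and> i = N - 1)"
proof (cases "i < N \<and> j < N")
  case True
  then show ?thesis using next_vertex_enum[OF strict_mono_on_id, of "{..<N}" N i j] assms by simp
qed (auto simp: next_vertex_def)

lemma sep_pair_lessThan:
  "sep_pair {..<N} i j \<longleftrightarrow> i + 2 \<le> j \<and> j < N \<and> (0 < i \<or> j + 1 < N)"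
proof (cases "i < N \<and> j < N")
  case True
  then show ?thesis using sep_pair_enum[OF strict_mono_on_id, of "{..<N}" N i j] by auto
qed (auto simp: sep_pair_def)

text \<open>At the first and the last vertex the neighbours wrap around and the wedge is an entry of
  row \<open>n + 1\<close> up to sign; \<open>frieze_row_below_ones\<close> and the periodicity turn
  it into an entry of the quiddity row.\<close>

lemma frieze_quiddity_wedge:
  assumes F: "frieze_pattern n F"
    and "next_vertex {..<n + 3} nat_cyc x y" "next_vertex {..<n + 3} nat_cyc y z"
  shows "\<bar>wedge (frieze_vector F x) (frieze_vector F z)\<bar> = F 2 (int y - 1)"
proof -
  note W = wedge_frieze_vector[OF F]
  have pos: "0 < F 2 k" for k using frieze_patternD(5)[OF F, of 1 k] by (simp add: numeral_2_eq_2)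
  have "y = Suc x \<and> z = Suc y \<or> x = n + 1 \<and> y = n + 2 \<and> z = 0 \<or> x = n + 2 \<and> y = 0 \<and> z = 1"
    using assms(2,3) next_vertex_lessThan[of "n + 3"] by auto
  then consider "y = Suc x" "z = x + 2" | "x = n + 1" "y = n + 2" "z = 0" | "x = n + 2" "y = 0" "z = 1"
    by auto
  then show ?thesis
  proof cases
    case 1
    then show ?thesis using W[of 2 x] pos[of "int x"] by simp
  next
    case 2
    then show ?thesis
      using W[of "n + 1" 0] pos[of "int (n + 1)"] frieze_row_below_ones[OF F, of 0]
        wedge_swap[of "frieze_vector F x" "frieze_vector F z"] by (simp add: add.commute)
  next
    case 3
    have "F (n + 1) 1 = F 2 (- 1)"
      using frieze_row_below_ones[OF F, of 1] quiddity_periodic[OF F, of "- 1"] by (simp add: algebra_simps)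
    then show ?thesis
      using 3 W[of "n + 1" 1] pos[of "- 1"]
        wedge_swap[of "frieze_vector F x" "frieze_vector F z"] by simp
  qed
qed

lemma typed_realization_frieze_vector:
  assumes F: "frieze_pattern n F" and T: "of_type_Lambda p F"
  shows "typed_realization p {..<n + 3} (frieze_vector F)"
  unfolding typed_realization_def realization_def
proof (intro conjI allI ballI impI)
  fix x y assume xy: "x \<in> {..<n + 3}" "y \<in> {..<n + 3}" "x < y"
  define r where "r = y - x"
  have r: "y = x + r" "0 < r" "r \<le> n + 2" using xy unfolding r_def by auto
  have W: "wedge (frieze_vector F x) (frieze_vector F y) = F r (int x)"
    using wedge_frieze_vector[OF F, of r x] r by simp
  show "0 < wedge (frieze_vector F x) (frieze_vector F y)"
    using frieze_patternD(5)[OF F, of "r - 1"] r unfolding W by simp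
  assume "\<not> sep_pair {..<n + 3} x y"
  then have "r = Suc 0 \<or> r = n + 2" using r xy by (auto simp: sep_pair_lessThan)
  then show "wedge (frieze_vector F x) (frieze_vector F y) = 1"
    using frieze_patternD(3,4)[OF F] unfolding W by metis
next
  fix x y z assume "next_vertex {..<n + 3} nat_cyc x y" "next_vertex {..<n + 3} nat_cyc y z"
  then show "\<exists>m::int. \<bar>wedge (frieze_vector F x) (frieze_vector F z)\<bar> = of_int m * frieze_lambda p"
    using frieze_quiddity_wedge[OF F] T unfolding of_type_Lambda_def quiddity_row_def by simp
qed

lemma angulated_frieze_vector:
  assumes "3 \<le> p" "frieze_pattern n F" "of_type_Lambda p F"
  shows "angulated p {..<n + 3} (frieze_vector F)"
  using angulated_of_typed_realization[OF assms(1)] typed_realization_frieze_vector[OF assms(2,3)] by simp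

text \<open>The quiddity at a vertex is \<open>frieze_lambda p\<close> times the number of
  subpolygons there, and this number depends on the unit diagonals only.\<close>

lemma frieze_pattern_unique:
  assumes p: "3 \<le> p" and F: "frieze_pattern n F" "of_type_Lambda p F"
    and G: "frieze_pattern n G" "of_type_Lambda p G"
    and eq: "unit_diagonals {..<n + 3} (frieze_vector F) = unit_diagonals {..<n + 3} (frieze_vector G)"
  shows "F = G"
proof (rule frieze_pattern_eqI[OF F(1) G(1)])
  fix k
  define N where "N = int (n + 3)"
  \<comment> \<open>The vertex that carries \<open>F 2 k\<close>: the shift by one of
    \<open>frieze_quiddity_wedge\<close>, reduced modulo the period.\<close>
  define y where "y = nat ((k + 1) mod N)"
  have N: "3 \<le> N" unfolding N_def by simp
  have y: "int y = (k + 1) mod N" using pos_mod_sign[of N "k + 1"] N unfolding y_def by simp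
  then have "int y < int (n + 3)" using pos_mod_bound[of N "k + 1"] N unfolding N_def by linarith
  then have yn: "y < n + 3" by linarith
  have "(int y - 1) mod N = k mod N" unfolding y by (simp add: mod_diff_left_eq)
  then have k: "F 2 k = F 2 (int y - 1)" "G 2 k = G 2 (int y - 1)"
    using quiddity_mod[OF F(1)] quiddity_mod[OF G(1)] unfolding N_def by metis+
  obtain x z where xz: "next_vertex {..<n + 3} nat_cyc x y" "next_vertex {..<n + 3} nat_cyc y z"
  proof -
    have "\<exists>c\<in>{..<n + 3}. y \<noteq> c" by (rule bexI[of _ "if y = 0 then 1 else 0"]) auto
    then obtain c where "c \<in> {..<n + 3}" "y \<noteq> c" by blast
    with yn have "\<exists>z. next_vertex {..<n + 3} nat_cyc y z" "\<exists>z. next_vertex {..<n + 3} nat_cyc z y"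
      using next_vertex_exists[OF finite_lessThan, of y "n + 3" c] by simp_all
    then show ?thesis using that by blast
  qed
  have "\<bar>wedge (frieze_vector F x) (frieze_vector F z)\<bar> = frieze_lambda p *
      real (card {S \<in> subpolygons {..<n + 3} nat_cyc (unit_diagonals {..<n + 3} (frieze_vector F)). y \<in> S})"
    using angulated_frieze_vector[OF p F] xz unfolding angulated_def by blast
  moreover have "\<bar>wedge (frieze_vector G x) (frieze_vector G z)\<bar> = frieze_lambda p *
      real (card {S \<in> subpolygons {..<n + 3} nat_cyc (unit_diagonals {..<n + 3} (frieze_vector G)). y \<in> S})"
    using angulated_frieze_vector[OF p G] xz unfolding angulated_def by blast
  ultimately show "F 2 k = G 2 k"
    using frieze_quiddity_wedge[OF F(1) xz] frieze_quiddity_wedge[OF G(1) xz] k eq by simp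
qed

section \<open>From realizations back to frieze patterns\<close>

text \<open>The extension of \<open>v\<close> from \<open>{..<N}\<close> to all integers with \<open>w (k + N) = - w k\<close>.\<close>

definition antiperiodic :: "nat \<Rightarrow> (nat \<Rightarrow> real \<times> real) \<Rightarrow> int \<Rightarrow> real \<times> real" where
  "antiperiodic N v k = (let s = (if even (k div int N) then 1 else - 1); u = v (nat (k mod int N))
     in (s * fst u, s * snd u))"

lemma wedge_antiperiodic:
  "wedge (antiperiodic N v k) (antiperiodic N v l) =
    (if even (k div int N) = even (l div int N) then 1 else - 1) *
    wedge (v (nat (k mod int N))) (v (nat (l mod int N)))"
  unfolding antiperiodic_def wedge_def Let_def by (simp add: algebra_simps)

text \<open>If \<open>k + r\<close> passes a multiple of \<open>N\<close>, the sign change cancels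
  against the exchanged order of the two vertices. At distance \<open>N\<close> the two vectors are
  opposite.\<close>

lemma wedge_antiperiodic_shift:
  assumes N: "0 < N" and r: "r < N"
  defines "i k \<equiv> nat (k mod int N)"
  shows "i k < N"
    and "wedge (antiperiodic N v k) (antiperiodic N v (k + int r)) =
      (if i k + r < N then wedge (v (i k)) (v (i k + r)) else wedge (v (i k + r - N)) (v (i k)))"
    and "wedge (antiperiodic N v k) (antiperiodic N v (k + int N)) = 0"
proof -
  have m: "0 \<le> k mod int N" "k mod int N < int N" using N by simp_all
  then show "i k < N" unfolding i_def using nat_less_iff by blast
  have i: "int (i k) = k mod int N" using m unfolding i_def by simp
  have k: "k = k div int N * int N + int (i k)" unfolding i by simp
  show "wedge (antiperiodic N v k) (antiperiodic N v (k + int N)) = 0"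
    unfolding wedge_antiperiodic using N by simp
  show "wedge (antiperiodic N v k) (antiperiodic N v (k + int r)) =
      (if i k + r < N then wedge (v (i k)) (v (i k + r)) else wedge (v (i k + r - N)) (v (i k)))"
  proof (cases "i k + r < N")
    case True
    have "k + int r = int N * (k div int N) + int (i k + r)" using k by (simp add: mult.commute)
    then have "(k + int r) div int N = k div int N" "(k + int r) mod int N = int (i k + r)"
      using True int_div_pos_eq[of "k + int r" "int N" "k div int N" "int (i k + r)"]
        int_mod_pos_eq[of "k + int r" "int N" "k div int N" "int (i k + r)"] by simp_all
    then show ?thesis
      using True nat_int[of "i k + r"] unfolding wedge_antiperiodic by (simp only:) (simp add: i_def)
  next
    case False
    have "i k + r - N < N" using \<open>i k < N\<close> r by simp
    moreover have "k + int r = int N * (k div int N + 1) + int (i k + r - N)"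
      using k False by (simp add: algebra_simps of_nat_diff)
    ultimately have "(k + int r) div int N = k div int N + 1" "(k + int r) mod int N = int (i k + r - N)"
      using int_div_pos_eq[of "k + int r" "int N" "k div int N + 1" "int (i k + r - N)"]
        int_mod_pos_eq[of "k + int r" "int N" "k div int N + 1" "int (i k + r - N)"] by simp_all
    then show ?thesis
      using False wedge_swap[of "v (i k)" "v (i k + r - N)"] nat_int[of "i k + r - N"]
      unfolding wedge_antiperiodic by (simp only:) (simp add: i_def)
  qed
qed

text \<open>The entries are the wedges of the antiperiodic vectors: antiperiodicity gives the zero
  row \<open>n + 3\<close>, and the diamond rule is the Pluecker relation with two unit
  edges.\<close>

lemma frieze_pattern_exists:
  assumes A: "angulated p {..<n + 3} v"
  shows "\<exists>F. frieze_pattern n F \<and> of_type_Lambda p F \<and>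
    unit_diagonals {..<n + 3} (frieze_vector F) = unit_diagonals {..<n + 3} v"
proof -
  define N where "N = n + 3"
  have N: "0 < N" "3 \<le> N" unfolding N_def by auto
  let ?w = "antiperiodic N v"
  define i where "i k = nat (k mod int N)" for k :: int
  \<comment> \<open>\<open>frieze_pattern\<close> prescribes the value \<open>0\<close> above row
    \<open>n + 3\<close>, hence the cut-off at \<open>N\<close>.\<close>
  define F where "F r k = (if r \<le> N then wedge (?w k) (?w (k + int r)) else 0)" for r k
  have r: "realization {..<N} v" using A unfolding angulated_def N_def by blast
  have pos: "0 < wedge (v a) (v b)" if "a < b" "b < N" for a b
    using realization_pos[OF r] that by simp
  have edge: "wedge (v a) (v b) = 1" if "b = Suc a \<or> a = 0 \<and> b = N - 1" "b < N" for a b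
    using realization_edge[OF r, of a b] that N by (auto simp: sep_pair_lessThan)
  have i: "i k < N" for k using wedge_antiperiodic_shift(1)[OF N(1), of 0 k] N unfolding i_def by simp
  have Fw: "F r k = (if i k + r < N then wedge (v (i k)) (v (i k + r)) else wedge (v (i k + r - N)) (v (i k)))"
    if "r < N" for r k
    using wedge_antiperiodic_shift(2)[OF N(1) that, of v k] that unfolding F_def i_def by simp
  have F0: "F 0 k = 0" and FN: "F N k = 0" for k
    using wedge_antiperiodic_shift(3)[OF N(1), of 0 v k] N unfolding F_def by auto
  have F1: "F 1 k = 1" for k
  proof (cases "i k + 1 < N")
    case True
    then show ?thesis using Fw[of 1 k] edge[of "Suc (i k)" "i k"] N by simp
  next
    case False
    then have "i k = N - 1" using i[of k] by linarith
    then show ?thesis using Fw[of 1 k] edge[of "N - 1" 0] N by simp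
  qed
  have FN1: "F (N - 1) k = 1" for k
    using Fw[of "N - 1" k] edge[of "i k" "i k - 1"] edge[of "N - 1" 0] i[of k] N
    by (cases "i k = 0") auto
  have Fpos: "0 < F r k" if "0 < r" "r < N" for r k
    using Fw[OF that(2)] pos[of "i k" "i k + r"] pos[of "i k + r - N" "i k"] i[of k] that by auto
  have "frieze_pattern n F"
    unfolding frieze_pattern_def
  proof (intro conjI allI ballI impI)
    show "F 0 k = 0" "F (n + 3) k = 0" "F 1 k = 1" "F (n + 2) k = 1" for k
      using F0 FN F1 FN1[of k] unfolding N_def by simp_all
    show "0 < F r k" if "r \<in> {2..n + 1}" for r k using Fpos that unfolding N_def by simp
    show "F r k = 0" if "n + 3 < r" for r k using that unfolding F_def N_def by simp
    show "F (r + 1) k * F (r + 1) (k + 1) - F (r + 2) k * F r (k + 1) = 1" if "r \<le> n + 1" for r k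
    proof -
      have one: "wedge (?w l) (?w (l + 1)) = 1" for l using F1[of l] N unfolding F_def by simp
      have "r + 2 \<le> N" using that unfolding N_def by simp
      then show ?thesis
        using wedge_pluecker[of "?w k" "?w (k + 1 + int r)" "?w (k + 1)" "?w (k + 2 + int r)"]
          one[of k] one[of "k + 1 + int r"] unfolding F_def by (simp add: add_ac)
    qed
  qed
  moreover have "of_type_Lambda p F"
    unfolding of_type_Lambda_def quiddity_row_def
  proof
    fix k
    have T: "typed_realization p {..<N} v"
      using typed_realization_of_angulated[OF A] unfolding N_def .
    have nxt: "next_vertex {..<N} nat_cyc a b \<longleftrightarrow> a < N \<and> b < N \<and> (b = Suc a \<or> b = 0 \<and> a = N - 1)" for a b
      using next_vertex_lessThan N by simp
    have typed: "\<exists>m::int. F 2 k = of_int m * frieze_lambda p"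
      if "F 2 k = \<bar>wedge (v a) (v c)\<bar>" "next_vertex {..<N} nat_cyc a b" "next_vertex {..<N} nat_cyc b c" for a b c
      using typed_realizationD[OF T that(2,3)] that(1) by metis
    \<comment> \<open>If the step by two wraps around, the middle vertex is \<open>N - 1\<close> or
      \<open>0\<close>, and the wedge is taken in reversed order.\<close>
    consider "i k + 2 < N" | "i k = N - 2" | "i k = N - 1" using i[of k] by linarith
    then show "\<exists>m::int. F 2 k = of_int m * frieze_lambda p"
    proof cases
      case 1
      then show ?thesis
        using Fw[of 2 k] pos[of "i k" "i k + 2"] N by (intro typed[of "i k" "i k + 2" "i k + 1"]) (auto simp: nxt)
    next
      case 2
      then show ?thesis
        using Fw[of 2 k] pos[of 0 "N - 2"] N wedge_swap[of "v 0" "v (N - 2)"]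
        by (intro typed[of "N - 2" 0 "N - 1"]) (auto simp: nxt)
    next
      case 3
      moreover have "1 < N - 1" using N by linarith
      ultimately show ?thesis
        using Fw[of 2 k] pos[of 1 "N - 1"] N wedge_swap[of "v 1" "v (N - 1)"]
        by (intro typed[of "N - 1" 1 0]) (auto simp: nxt)
    qed
  qed
  moreover have "unit_diagonals {..<N} (frieze_vector F) = unit_diagonals {..<N} v"
  proof -
    have "wedge (frieze_vector F x) (frieze_vector F y) = wedge (v x) (v y)" if "x < y" "y < N" for x y
    proof -
      have "wedge (frieze_vector F x) (frieze_vector F (x + (y - x))) = F (y - x) (int x)"
        using wedge_frieze_vector[OF calculation(1), of "y - x" x] that unfolding N_def by simp
      moreover have "i (int x) = x" using that unfolding i_def by simp
      ultimately show ?thesis using Fw[of "y - x" "int x"] that by simp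
    qed
    then have "sep_pair {..<N} x y \<and> wedge (frieze_vector F x) (frieze_vector F y) = 1 \<longleftrightarrow>
      sep_pair {..<N} x y \<and> wedge (v x) (v y) = 1" for x y
      by (auto simp: sep_pair_def)
    then show ?thesis unfolding unit_diagonals_def by simp
  qed
  ultimately show ?thesis unfolding N_def by blast
qed

text \<open>The map starts at the frieze patterns because it has an explicit formula in this
  direction. For surjectivity a \<open>p\<close>-angulation is realized and a frieze is read off the
  realization.\<close>

lemma bij_betw_frieze_angulation:
  assumes p: "3 \<le> p"
  shows "bij_betw (\<lambda>F. unit_diagonals {..<n + 3} (frieze_vector F))
    {F. frieze_pattern n F \<and> of_type_Lambda p F} {D. p_angulation p {..<n + 3} nat_cyc D}"
proof (intro bij_betw_imageI inj_onI equalityI subsetI)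
  fix F G assume "F \<in> {F. frieze_pattern n F \<and> of_type_Lambda p F}"
    "G \<in> {F. frieze_pattern n F \<and> of_type_Lambda p F}"
    "unit_diagonals {..<n + 3} (frieze_vector F) = unit_diagonals {..<n + 3} (frieze_vector G)"
  then show "F = G" using frieze_pattern_unique[OF p] by blast
next
  fix D assume "D \<in> (\<lambda>F. unit_diagonals {..<n + 3} (frieze_vector F)) ` {F. frieze_pattern n F \<and> of_type_Lambda p F}"
  then show "D \<in> {D. p_angulation p {..<n + 3} nat_cyc D}"
    using angulated_frieze_vector[OF p] unfolding angulated_def by blast
next
  fix D assume "D \<in> {D. p_angulation p {..<n + 3} nat_cyc D}"
  then obtain v where "angulated p {..<n + 3} v" "unit_diagonals {..<n + 3} v = D"
    using angulated_exists[OF p, of "{..<n + 3}" D] by auto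
  then show "D \<in> (\<lambda>F. unit_diagonals {..<n + 3} (frieze_vector F)) ` {F. frieze_pattern n F \<and> of_type_Lambda p F}"
    using frieze_pattern_exists by blast
qed

section \<open>Transfer to arbitrary polygons\<close>

lemma inj_on_image_subset_iff:
  assumes "inj_on f C" "A \<subseteq> C" "B \<subseteq> C"
  shows "f ` A \<subseteq> f ` B \<longleftrightarrow> A \<subseteq> B"
proof
  assume *: "f ` A \<subseteq> f ` B"
  show "A \<subseteq> B"
  proof
    fix x assume "x \<in> A"
    moreover from this obtain y where "y \<in> B" "f x = f y" using * by blast
    ultimately show "x \<in> B" using assms inj_onD[of f C x y] by blast
  qed
qed (rule image_mono)

section \<open>Invariance of dissections under embeddings of cyclic orders\<close>

context
  fixes e :: "'a \<Rightarrow> 'b" and V :: "'a set" and cyc :: "'a \<Rightarrow> 'a \<Rightarrow> 'a \<Rightarrow> bool"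
    and cyc' :: "'b \<Rightarrow> 'b \<Rightarrow> 'b \<Rightarrow> bool"
  assumes inj: "inj_on e V"
    and cyc: "\<And>x y z. x \<in> V \<Longrightarrow> y \<in> V \<Longrightarrow> z \<in> V \<Longrightarrow> cyc' (e x) (e y) (e z) \<longleftrightarrow> cyc x y z"
begin

lemma embedding_eq_iff: "x \<in> V \<Longrightarrow> y \<in> V \<Longrightarrow> e x = e y \<longleftrightarrow> x = y"
  using inj by (auto dest: inj_onD)

lemma polygon_image:
  assumes "S \<subseteq> V"
  shows "polygon (e ` S) cyc' \<longleftrightarrow> polygon S cyc"
proof -
  have i: "inj_on e S" using inj assms by (rule inj_on_subset)
  have "finite (e ` S) \<longleftrightarrow> finite S" "card (e ` S) = card S"
    using i by (simp_all add: finite_image_iff card_image)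
  moreover have c: "cyc' (e x) (e y) (e z) \<longleftrightarrow> cyc x y z" "e x = e y \<longleftrightarrow> x = y"
    if "x \<in> S" "y \<in> S" "z \<in> S" for x y z
    using cyc[of x y z] embedding_eq_iff[of x y] that assms by auto
  have "cyclic_ordering_on (e ` S) cyc' \<longleftrightarrow> cyclic_ordering_on S cyc"
    unfolding cyclic_ordering_on_def ball_simps by (simp add: c cong: ball_cong)
  ultimately show ?thesis unfolding polygon_def by simp
qed

lemma adjacent_image:
  assumes "S \<subseteq> V" "x \<in> S" "y \<in> S"
  shows "adjacent (e ` S) cyc' (e x) (e y) \<longleftrightarrow> adjacent S cyc x y"
proof -
  have "next_vertex (e ` S) cyc' (e x) (e y) \<longleftrightarrow> next_vertex S cyc x y" if "x \<in> S" "y \<in> S" for x y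
  proof -
    have "cyc' (e x) (e z) (e y) \<longleftrightarrow> cyc x z y" if "z \<in> S" for z
      using cyc[of x z y] that \<open>x \<in> S\<close> \<open>y \<in> S\<close> assms(1) by auto
    moreover have "e x = e y \<longleftrightarrow> x = y" using embedding_eq_iff[of x y] that assms(1) by auto
    ultimately show ?thesis using that unfolding next_vertex_def by auto
  qed
  then show ?thesis using assms unfolding adjacent_def by simp
qed

lemma polygon_edges_image:
  assumes "S \<subseteq> V"
  shows "polygon_edges (e ` S) cyc' = (`) e ` polygon_edges S cyc"
proof (intro equalityI subsetI)
  fix d assume "d \<in> polygon_edges (e ` S) cyc'"
  then obtain x' y' where d: "d = {x', y'}" "adjacent (e ` S) cyc' x' y'"
    unfolding polygon_edges_def by blast
  then have "x' \<in> e ` S" "y' \<in> e ` S" unfolding adjacent_def next_vertex_def by auto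
  then obtain x y where "x \<in> S" "y \<in> S" "x' = e x" "y' = e y" by blast
  then have "d = e ` {x, y}" "adjacent S cyc x y" using adjacent_image[OF assms] d by auto
  then show "d \<in> (`) e ` polygon_edges S cyc" unfolding polygon_edges_def by blast
next
  fix d assume "d \<in> (`) e ` polygon_edges S cyc"
  then obtain x y where d: "d = e ` {x, y}" "adjacent S cyc x y"
    unfolding polygon_edges_def by blast
  then have "x \<in> S" "y \<in> S" unfolding adjacent_def next_vertex_def by auto
  then have "adjacent (e ` S) cyc' (e x) (e y)" using adjacent_image[OF assms] d by blast
  then show "d \<in> polygon_edges (e ` S) cyc'" using d unfolding polygon_edges_def by auto
qed

lemma diagonals_image:
  assumes "S \<subseteq> V"
  shows "diagonals (e ` S) cyc' = (`) e ` diagonals S cyc"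
proof (intro equalityI subsetI)
  fix d assume "d \<in> diagonals (e ` S) cyc'"
  then obtain x y where d: "d = {e x, e y}" "x \<in> S" "y \<in> S" "e x \<noteq> e y" "\<not> adjacent (e ` S) cyc' (e x) (e y)"
    unfolding diagonals_def by blast
  then have "d = e ` {x, y}" "x \<noteq> y" "\<not> adjacent S cyc x y" using adjacent_image[OF assms] by auto
  then show "d \<in> (`) e ` diagonals S cyc" using d(2,3) unfolding diagonals_def by blast
next
  fix d assume "d \<in> (`) e ` diagonals S cyc"
  then obtain x y where d: "d = e ` {x, y}" "x \<in> S" "y \<in> S" "x \<noteq> y" "\<not> adjacent S cyc x y"
    unfolding diagonals_def by blast
  then have "\<not> adjacent (e ` S) cyc' (e x) (e y)" "e x \<noteq> e y"
    using adjacent_image[OF assms] embedding_eq_iff[of x y] assms by auto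
  then show "d \<in> diagonals (e ` S) cyc'" using d unfolding diagonals_def by auto
qed

lemma crossing_image:
  assumes "d \<subseteq> V" "d' \<subseteq> V"
  shows "crossing cyc' (e ` d) (e ` d') \<longleftrightarrow> crossing cyc d d'"
proof
  assume "crossing cyc d d'"
  then obtain a b c f where *: "d = {a, b}" "d' = {c, f}" "distinct [a, b, c, f]"
    "in_cyclic_order cyc a c b f \<or> in_cyclic_order cyc a f b c"
    unfolding crossing_def by blast
  then have "a \<in> V" "b \<in> V" "c \<in> V" "f \<in> V" using assms by auto
  then have "distinct [e a, e b, e c, e f]"
    "in_cyclic_order cyc' (e a) (e c) (e b) (e f) \<or> in_cyclic_order cyc' (e a) (e f) (e b) (e c)"
    using * cyc embedding_eq_iff unfolding in_cyclic_order_def by auto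
  moreover have "e ` d = {e a, e b}" "e ` d' = {e c, e f}" using * by auto
  ultimately show "crossing cyc' (e ` d) (e ` d')" unfolding crossing_def by blast
next
  assume "crossing cyc' (e ` d) (e ` d')"
  then obtain a' b' c' f' where *: "e ` d = {a', b'}" "e ` d' = {c', f'}" "distinct [a', b', c', f']"
    "in_cyclic_order cyc' a' c' b' f' \<or> in_cyclic_order cyc' a' f' b' c'"
    unfolding crossing_def by blast
  then have "a' \<in> e ` d" "b' \<in> e ` d" "c' \<in> e ` d'" "f' \<in> e ` d'" by auto
  then obtain a b c f where abcf: "a \<in> d" "b \<in> d" "c \<in> d'" "f \<in> d'" "a' = e a" "b' = e b" "c' = e c" "f' = e f"
    by blast
  then have V: "a \<in> V" "b \<in> V" "c \<in> V" "f \<in> V" using assms by auto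
  have "e ` d = e ` {a, b}" "e ` d' = e ` {c, f}" using * abcf by auto
  then have "d = {a, b}" "d' = {c, f}"
    using inj_on_image_eq_iff[OF inj] assms V by (metis empty_subsetI insert_subset)+
  moreover have "distinct [a, b, c, f]" using *(3) abcf by auto
  moreover have "in_cyclic_order cyc a c b f \<or> in_cyclic_order cyc a f b c"
    using *(4) V cyc unfolding abcf in_cyclic_order_def by auto
  ultimately show "crossing cyc d d'" unfolding crossing_def by blast
qed

lemma subpolygons_image:
  assumes D: "D \<subseteq> Pow V"
  shows "subpolygons (e ` V) cyc' ((`) e ` D) = (`) e ` subpolygons V cyc D"
proof -
  have inj2: "inj_on ((`) e) (Pow V)" using inj by (rule inj_on_image_Pow)
  have Pow: "polygon_edges S cyc \<subseteq> Pow V" "diagonals S cyc \<subseteq> Pow V" if "S \<subseteq> V" for S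
    using that unfolding polygon_edges_def diagonals_def adjacent_def next_vertex_def by auto
  have *: "e ` S \<in> subpolygons (e ` V) cyc' ((`) e ` D) \<longleftrightarrow> S \<in> subpolygons V cyc D" if S: "S \<subseteq> V" for S
  proof -
    have "polygon_edges (e ` S) cyc' \<subseteq> polygon_edges (e ` V) cyc' \<union> (`) e ` D \<longleftrightarrow>
        (`) e ` polygon_edges S cyc \<subseteq> (`) e ` (polygon_edges V cyc \<union> D)"
      unfolding polygon_edges_image[OF S] polygon_edges_image[OF subset_refl] image_Un ..
    also have "\<dots> \<longleftrightarrow> polygon_edges S cyc \<subseteq> polygon_edges V cyc \<union> D"
      by (rule inj_on_image_subset_iff[OF inj2]) (use Pow[OF S] Pow(1)[OF subset_refl] D in auto)
    finally have 1: "polygon_edges (e ` S) cyc' \<subseteq> polygon_edges (e ` V) cyc' \<union> (`) e ` D \<longleftrightarrow>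
      polygon_edges S cyc \<subseteq> polygon_edges V cyc \<union> D" .
    have "diagonals (e ` S) cyc' \<inter> (`) e ` D = (`) e ` (diagonals S cyc \<inter> D)"
      unfolding diagonals_image[OF S] by (rule inj_on_image_Int[OF inj2 Pow(2)[OF S] D, symmetric])
    then have 2: "diagonals (e ` S) cyc' \<inter> (`) e ` D = {} \<longleftrightarrow> diagonals S cyc \<inter> D = {}" by simp
    have 3: "e ` S \<subseteq> e ` V \<longleftrightarrow> S \<subseteq> V" using S by blast
    show ?thesis unfolding subpolygons_def mem_Collect_eq 1 2 3 polygon_image[OF S] ..
  qed
  show ?thesis
  proof (intro equalityI subsetI)
    fix T assume T: "T \<in> subpolygons (e ` V) cyc' ((`) e ` D)"
    then have "T \<subseteq> e ` V" unfolding subpolygons_def by blast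
    then obtain S where "S \<subseteq> V" "T = e ` S" by (metis subset_imageE)
    then show "T \<in> (`) e ` subpolygons V cyc D" using * T by blast
  next
    fix T assume "T \<in> (`) e ` subpolygons V cyc D"
    then obtain S where "S \<in> subpolygons V cyc D" "T = e ` S" by blast
    moreover from this have "S \<subseteq> V" unfolding subpolygons_def by blast
    ultimately show "T \<in> subpolygons (e ` V) cyc' ((`) e ` D)" using * by simp
  qed
qed

lemma p_angulation_image:
  assumes D: "D \<subseteq> Pow V"
  shows "p_angulation p (e ` V) cyc' ((`) e ` D) \<longleftrightarrow> p_angulation p V cyc D"
proof -
  have inj2: "inj_on ((`) e) (Pow V)" using inj by (rule inj_on_image_Pow)
  have "diagonals V cyc \<subseteq> Pow V" unfolding diagonals_def by auto
  then have "(`) e ` D \<subseteq> diagonals (e ` V) cyc' \<longleftrightarrow> D \<subseteq> diagonals V cyc"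
    unfolding diagonals_image[OF subset_refl] using inj_on_image_subset_iff[OF inj2 D] by simp
  moreover have "crossing cyc' (e ` d) (e ` d') \<longleftrightarrow> crossing cyc d d'" if "d \<in> D" "d' \<in> D" for d d'
    using that D by (intro crossing_image) auto
  ultimately have "polygon_dissection (e ` V) cyc' ((`) e ` D) \<longleftrightarrow> polygon_dissection V cyc D"
    unfolding polygon_dissection_def by simp
  moreover have "card (e ` S) = card S" if "S \<in> subpolygons V cyc D" for S
    using that inj_on_subset[OF inj] unfolding subpolygons_def by (simp add: card_image)
  ultimately show ?thesis unfolding p_angulation_def subpolygons_image[OF D] by simp
qed

lemma p_angulation_Pow: "p_angulation p W c D \<Longrightarrow> D \<subseteq> Pow W"
  unfolding p_angulation_def polygon_dissection_def diagonals_def by auto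

text \<open>\<open>e\<close> is lifted twice, to diagonals and then to dissections. Injectivity
  passes to each power set, and every set of subsets of the image has a preimage.\<close>

lemma bij_betw_p_angulations:
  "bij_betw ((`) ((`) e)) {D. p_angulation p V cyc D} {D. p_angulation p (e ` V) cyc' D}"
proof -
  note Pow = p_angulation_Pow
  show ?thesis
  proof (intro bij_betw_imageI equalityI subsetI)
    have "inj_on ((`) ((`) e)) (Pow (Pow V))" by (intro inj_on_image_Pow inj)
    then show "inj_on ((`) ((`) e)) {D. p_angulation p V cyc D}"
    proof (rule inj_on_subset)
      show "{D. p_angulation p V cyc D} \<subseteq> Pow (Pow V)" using Pow[of p V cyc] by blast
    qed
  next
    fix E assume "E \<in> (`) ((`) e) ` {D. p_angulation p V cyc D}"
    then obtain D where "p_angulation p V cyc D" "E = (`) e ` D" by blast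
    then show "E \<in> {D. p_angulation p (e ` V) cyc' D}"
      using p_angulation_image[OF Pow, of p cyc D p] by simp
  next
    fix E assume "E \<in> {D. p_angulation p (e ` V) cyc' D}"
    then have E: "p_angulation p (e ` V) cyc' E" by simp
    have "E \<subseteq> (`) e ` Pow V" using Pow[OF E] by (simp add: image_Pow_surj)
    then obtain D where D: "D \<subseteq> Pow V" "E = (`) e ` D" by (metis subset_imageE)
    then have "p_angulation p V cyc D" using E p_angulation_image[OF D(1)] by simp
    then show "E \<in> (`) ((`) e) ` {D. p_angulation p V cyc D}" using D(2) by blast
  qed
qed

end

section \<open>Linearizing a cyclic order\<close>

text \<open>Cutting the cyclic order open at one vertex \<open>c0\<close> makes it a linear order
  with least element \<open>c0\<close>; the rank in it is the enumeration.\<close>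

lemma cyclic_ordering_enumeration:
  assumes V: "finite V" and C: "cyclic_ordering_on V cyc"
  shows "\<exists>e::'a \<Rightarrow> nat. inj_on e V \<and> e ` V = {..<card V} \<and>
    (\<forall>x\<in>V. \<forall>y\<in>V. \<forall>z\<in>V. nat_cyc (e x) (e y) (e z) \<longleftrightarrow> cyc x y z)"
proof (cases "V = {}")
  case False
  then obtain c0 where c0: "c0 \<in> V" by blast
  have rot: "cyc a b c \<Longrightarrow> cyc b c a" if "a \<in> V" "b \<in> V" "c \<in> V" for a b c
    using C that unfolding cyclic_ordering_on_def by blast
  have asym: "cyc a b c \<Longrightarrow> \<not> cyc c b a" if "a \<in> V" "b \<in> V" "c \<in> V" for a b c
    using C that unfolding cyclic_ordering_on_def by blast
  have trans: "cyc a b c \<Longrightarrow> cyc a c d \<Longrightarrow> cyc a b d" if "a \<in> V" "b \<in> V" "c \<in> V" "d \<in> V" for a b c d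
    using C that unfolding cyclic_ordering_on_def by blast
  have total: "cyc a b c \<or> cyc c b a" if "a \<in> V" "b \<in> V" "c \<in> V" "a \<noteq> b" "b \<noteq> c" "a \<noteq> c" for a b c
    using C that unfolding cyclic_ordering_on_def by blast
  \<comment> \<open>If two entries coincided, some rotation of the triple would be its own reversal,
    against asymmetry.\<close>
  have dist: "a \<noteq> b \<and> b \<noteq> c \<and> a \<noteq> c" if "a \<in> V" "b \<in> V" "c \<in> V" "cyc a b c" for a b c
    using that rot asym by metis
  define lt where "lt x y \<longleftrightarrow> x = c0 \<and> y \<noteq> c0 \<or> cyc c0 x y" for x y
  have lt_trans: "lt x z" if "x \<in> V" "y \<in> V" "z \<in> V" "lt x y" "lt y z" for x y z
    using that c0 dist trans[of c0 x y z] unfolding lt_def by blast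
  have lt_irrefl: "\<not> lt x x" if "x \<in> V" for x
    using that c0 dist unfolding lt_def by blast
  have lt_total: "lt x y \<or> lt y x" if "x \<in> V" "y \<in> V" "x \<noteq> y" for x y
    using that c0 total[of c0 x y] rot unfolding lt_def by metis
  have lt_cyc: "cyc x y z" if xyz: "x \<in> V" "y \<in> V" "z \<in> V" "lt x y" "lt y z" for x y z
  proof (cases "x = c0")
    case True
    then show ?thesis using xyz lt_irrefl unfolding lt_def by metis
  next
    case False
    then have "cyc c0 x y" "cyc c0 y z" using xyz dist c0 unfolding lt_def by blast+
    \<comment> \<open>Rotating both triples to start at \<open>y\<close> lets transitivity eliminate
      \<open>c0\<close>.\<close>
    then have "cyc y z c0" "cyc y c0 x" using rot c0 xyz by blast+
    then have "cyc y z x" using trans[of y z c0 x] c0 xyz by blast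
    then show ?thesis using rot xyz by blast
  qed
  define e where "e x = card {y\<in>V. lt y x}" for x
  have e_less: "e x < e y" if "x \<in> V" "y \<in> V" "lt x y" for x y
  proof -
    have "{z\<in>V. lt z x} \<subset> {z\<in>V. lt z y}" using that lt_trans lt_irrefl by blast
    then show ?thesis unfolding e_def using V by (intro psubset_card_mono) auto
  qed
  have e_iff: "e x < e y \<longleftrightarrow> lt x y" if "x \<in> V" "y \<in> V" for x y
    using e_less[of x y] e_less[of y x] lt_total[of x y] that by (cases "x = y") auto
  have inj: "inj_on e V"
    using e_less lt_total by (intro inj_onI) (metis less_irrefl)
  have "e x < card V" if "x \<in> V" for x
  proof -
    have "{y\<in>V. lt y x} \<subset> V" using that lt_irrefl by blast
    then show ?thesis unfolding e_def using V by (intro psubset_card_mono)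
  qed
  then have "e ` V = {..<card V}"
    using V inj by (intro card_subset_eq) (auto simp: card_image)
  moreover have "nat_cyc (e x) (e y) (e z) \<longleftrightarrow> cyc x y z" if xyz: "x \<in> V" "y \<in> V" "z \<in> V" for x y z
  proof
    assume "nat_cyc (e x) (e y) (e z)"
    then have "lt x y \<and> lt y z \<or> lt y z \<and> lt z x \<or> lt z x \<and> lt x y"
      unfolding nat_cyc_def using e_iff xyz by simp
    then show "cyc x y z" using lt_cyc rot xyz by metis
  next
    assume c: "cyc x y z"
    show "nat_cyc (e x) (e y) (e z)"
    proof (rule ccontr)
      assume n: "\<not> nat_cyc (e x) (e y) (e z)"
      have "e x \<noteq> e y" "e y \<noteq> e z" "e x \<noteq> e z"
        using dist[OF xyz c] inj xyz by (auto dest: inj_onD)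
      \<comment> \<open>Three distinct ranks that are not in cyclic order are in the reverse one,
        which leads back to the reversed triple in \<open>V\<close>.\<close>
      then have "nat_cyc (e z) (e y) (e x)" using n unfolding nat_cyc_def by linarith
      then have "lt z y \<and> lt y x \<or> lt y x \<and> lt x z \<or> lt x z \<and> lt z y"
        unfolding nat_cyc_def using e_iff xyz by simp
      then have "cyc z y x" using lt_cyc rot xyz by metis
      then show False using asym xyz c by blast
    qed
  qed
  ultimately show ?thesis using inj by blast
qed simp

section \<open>The bijection\<close>

theorem theoremA:
  fixes p n :: nat
    and V :: "'a set"
    and cyc :: "'a \<Rightarrow> 'a \<Rightarrow> 'a \<Rightarrow> bool"
  assumes "p \<ge> 3"
    and "polygon V cyc"
    and "card V = n + 3"
  shows "\<exists>f. bij_betw f {D. p_angulation p V cyc D}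
                        {F. frieze_pattern n F \<and> of_type_Lambda p F}"
proof -
  have V: "finite V" "cyclic_ordering_on V cyc" using assms(2) unfolding polygon_def by auto
  from cyclic_ordering_enumeration[OF V] obtain e :: "'a \<Rightarrow> nat"
    where e: "inj_on e V" "e ` V = {..<card V}"
      "\<forall>x\<in>V. \<forall>y\<in>V. \<forall>z\<in>V. nat_cyc (e x) (e y) (e z) \<longleftrightarrow> cyc x y z"
    by (elim exE conjE)
  have *: "bij_betw ((`) ((`) e)) {D. p_angulation p V cyc D} {D. p_angulation p (e ` V) nat_cyc D}"
    by (rule bij_betw_p_angulations) (use e in auto)
  \<comment> \<open>The explicit bijection goes from frieze patterns to angulations of the model
    polygon, so its inverse is composed with the transport along \<open>e\<close>.\<close>
  show ?thesis
    using bij_betw_trans[OF *[unfolded e(2) assms(3)]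
      bij_betw_inv_into[OF bij_betw_frieze_angulation[OF assms(1), of n]]] by (intro exI)
qed

end
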